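(* Let $G$ be a unicyclic graph with $n$ vertices and girth $m$, where $n\ge6$ and $3\le m\le n-2$. Then ${}^rD'(G)\le{}^rD'\big(U_{n,m,n-\lfloor\frac{m+1}{2}\rfloor}\big)$, with equality if and only if $G\cong U_{n,m,n-\lfloor\frac{m+1}{2}\rfloor}$.
   Context: All graphs are finite, simple and connected. For a graph $G$, $d_G(x,y)$ is the distance, $D_G(x)=\sum_{y}d_G(x,y)$, $d_G(x)$ the degree, and $D'(G)=\sum_{x}d_G(x)D_G(x)$ the degree distance. The reverse degree distance of a graph $G$ with $n$ vertices, $e$ edges and diameter $d$ is ${}^rD'(G)=2(n-1)ed-D'(G)$. A unicyclic graph is a connected graph with exactly one cycle; its girth is the length of that cycle. Attaching a path $P_s$ ($s\ge1$) to $w$ means adding new vertices $w_1,\dots,w_s$ with edges $ww_1,w_1w_2,\dots,w_{s-1}w_s$ (nothing for $s=0$); attaching $h$ pendant vertices to $w$ means adding $h$ new vertices each joined only to $w$. For integers $n,m,d$ let $h=n-d-\lfloor\frac{m+1}{2}\rfloor$ and $\alpha=\frac{h\lfloor m/2\rfloor}{n-d-\frac12}$; let $\gamma,\theta$ be nonnegative integers with $\gamma+\theta=d-\lfloor\frac m2\rfloor$ such that $\gamma-\theta$ is as large as possible subject to $\gamma-\theta\le\alpha+1$. $U_{n,m,d}$ is the graph obtained from the cycle $C_m=v_0v_1\cdots v_{m-1}v_0$ by attaching a path $P_\gamma$ to $v_0$, a path $P_\theta$ to $v_{\lfloor m/2\rfloor}$, and $h$ pendant vertices to $v_0$. (In particular,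 for $d=n-\lfloor\frac{m+1}{2}\rfloor$ one has $h=0$.) *)

theory Defs
  imports Complex_Main
begin

record 'a ugraph =
  verts :: "'a set"
  edges :: "'a set set"

definition simple_graph :: "'a ugraph \<Rightarrow> bool" where
  "simple_graph G \<longleftrightarrow> finite (verts G) \<and> (\<forall>e\<in>edges G. e \<subseteq> verts G \<and> card e = 2)"

definition walk :: "'a ugraph \<Rightarrow> 'a \<Rightarrow> 'a list \<Rightarrow> 'a \<Rightarrow> bool" where
  "walk G u xs v \<longleftrightarrow> xs \<noteq> [] \<and> hd xs = u \<and> last xs = v \<and> set xs \<subseteq> verts G \<and>
     successively (\<lambda>x y. {x, y} \<in> edges G) xs"

definition connected_graph :: "'a ugraph \<Rightarrow> bool" where
  "connected_graph G \<longleftrightarrow>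
     verts G \<noteq> {} \<and> (\<forall>u\<in>verts G. \<forall>v\<in>verts G. \<exists>xs. walk G u xs v)"

text \<open>A walk is given by its vertices, so its length is one less than that of the list.\<close>

definition gdist :: "'a ugraph \<Rightarrow> 'a \<Rightarrow> 'a \<Rightarrow> nat" where
  "gdist G u v = (LEAST k. \<exists>xs. walk G u xs v \<and> length xs = Suc k)"

definition degree :: "'a ugraph \<Rightarrow> 'a \<Rightarrow> nat" where
  "degree G v = card {e \<in> edges G. v \<in> e}"

definition diameter :: "'a ugraph \<Rightarrow> nat" where
  "diameter G = Max {gdist G u v | u v. u \<in> verts G \<and> v \<in> verts G}"

definition dist_sum :: "'a ugraph \<Rightarrow> 'a \<Rightarrow> nat" where
  "dist_sum G x = (\<Sum>y\<in>verts G. gdist G x y)"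

definition degree_distance :: "'a ugraph \<Rightarrow> nat" where
  "degree_distance G = (\<Sum>x\<in>verts G. degree G x * dist_sum G x)"

definition reverse_degree_distance :: "'a ugraph \<Rightarrow> int" where
  "reverse_degree_distance G =
     2 * (int (card (verts G)) - 1) * int (card (edges G)) * int (diameter G)
     - int (degree_distance G)"

definition cycle_edges :: "'a list \<Rightarrow> 'a set set" where
  "cycle_edges xs = {{xs ! i, xs ! (Suc i mod length xs)} | i. i < length xs}"

text \<open>
  A cycle subgraph is determined by its edge set, which is independent of the starting point
  and the orientation of the list presenting it. The number of its edges is its length.
\<close>

definition cycles :: "'a ugraph \<Rightarrow> 'a set set set" where
  "cycles G = {cycle_edges xs | xs.
     3 \<le> length xs \<and> distinct xs \<and> set xs \<subseteq> verts G \<and> cycle_edges xs \<subseteq> edges G}"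

definition unicyclic :: "'a ugraph \<Rightarrow> bool" where
  "unicyclic G \<longleftrightarrow> simple_graph G \<and> connected_graph G \<and> (\<exists>!C. C \<in> cycles G)"

text \<open>The girth is only used for unicyclic graphs, as the length of the unique cycle.\<close>

definition girth :: "'a ugraph \<Rightarrow> nat" where
  "girth G = card (THE C. C \<in> cycles G)"

definition isomorphic :: "'a ugraph \<Rightarrow> 'b ugraph \<Rightarrow> bool" where
  "isomorphic G H \<longleftrightarrow> (\<exists>f. bij_betw f (verts G) (verts H) \<and>
     (\<forall>u\<in>verts G. \<forall>v\<in>verts G. {u, v} \<in> edges G \<longleftrightarrow> {f u, f v} \<in> edges H))"

text \<open>
  The parameters below are meaningful for \<open>m div 2 \<le> d\<close> and \<open>d + (m + 1) div 2 \<le> n\<close>,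
  where none of the subtractions on natural numbers truncates.
\<close>

definition num_pendants :: "nat \<Rightarrow> nat \<Rightarrow> nat \<Rightarrow> nat" where
  "num_pendants n m d = n - d - (m + 1) div 2"

definition alpha :: "nat \<Rightarrow> nat \<Rightarrow> nat \<Rightarrow> real" where
  "alpha n m d = real (num_pendants n m d) * real (m div 2) / (real n - real d - 1 / 2)"

text \<open>
  The pair \<open>(\<gamma>, \<theta>)\<close>. As the sum is prescribed, maximising the difference determines it uniquely.
\<close>

definition path_lengths :: "nat \<Rightarrow> nat \<Rightarrow> nat \<Rightarrow> nat \<times> nat" where
  "path_lengths n m d =
     arg_max (\<lambda>(\<gamma>, \<theta>). int \<gamma> - int \<theta>)
       (\<lambda>(\<gamma>, \<theta>). \<gamma> + \<theta> + m div 2 = d \<and> real \<gamma> - real \<theta> \<le> alpha n m d + 1)"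

text \<open>
  \<open>Cyc i\<close> is the cycle vertex \<open>v\<^sub>i\<close>; \<open>PathA i\<close> and \<open>PathB i\<close> (\<open>i \<ge> 1\<close>) are the \<open>i\<close>-th new
  vertices of the paths attached to \<open>v\<^sub>0\<close> and to the opposite vertex, respectively.
\<close>

datatype uvertex = Cyc nat | PathA nat | PathB nat | Pendant nat

definition attached_path_edges :: "'a \<Rightarrow> (nat \<Rightarrow> 'a) \<Rightarrow> nat \<Rightarrow> 'a set set" where
  "attached_path_edges w p s = {{if i = 0 then w else p i, p (Suc i)} | i. i < s}"

definition U_graph :: "nat \<Rightarrow> nat \<Rightarrow> nat \<Rightarrow> uvertex ugraph" where
  "U_graph n m d =
     (let h = num_pendants n m d; (\<gamma>, \<theta>) = path_lengths n m d in
      \<lparr> verts = Cyc ` {..<m} \<union> PathA ` {1..\<gamma>} \<union> PathB ` {1..\<theta>} \<union> Pendant ` {..<h},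
        edges = cycle_edges (map Cyc [0..<m])
          \<union> attached_path_edges (Cyc 0) PathA \<gamma>
          \<union> attached_path_edges (Cyc (m div 2)) PathB \<theta>
          \<union> {{Cyc 0, Pendant j} | j. j < h} \<rparr>)"

end

theory Submission
  imports Defs
begin

text \<open>
  Induction on the number of vertices: the vertex \<open>v\<close> farthest from the cycle is a leaf; remove it.
  For a unicyclic graph with \<open>n\<close> vertices, girth \<open>m\<close> and \<open>c = (m - 1) div 2\<close>, attaching a leaf at \<open>w\<close>
  increases the degree distance by \<open>4 D(w) + 2 n + m + 2 d(w, C) + 1\<close>. If this increases the diameter,
  then \<open>w\<close> is an end of a diametral path, so from \<open>w\<close> every level up to the diameter is
  nonempty and \<open>c\<close> levels just beyond \<open>d(w, C)\<close> contain two cycle vertices. This bounds \<open>D(w)\<close> from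
  below, and together with \<open>d(x, y) \<le> d(x, C) + d(y, C) + m div 2\<close> it shows that no leaf
  yields a larger gain than in a cycle with two balanced arms. In the case of equality \<open>w\<close> has
  the same distance to the cycle and the same eccentricity as the end of the shorter arm, which
  determines it up to symmetry. If the diameter does not increase, then the gain is strictly smaller.
\<close>

section \<open>Walks and distances\<close>

text \<open>The prescribed diameter leaves h = 0 and is the largest one possible for n vertices and
  girth m, so U is a cycle with two arms of nearly equal length. Without the vertex attached last it
  is the extremal graph for n - 1, so it suffices to compare single gains. The lower bound for D(w)
  increases with \<delta>(w), so the gain can only be bounded once \<delta>(w) is known not to be
  small. This is why a farthest vertex is removed: every remaining y then has \<delta>(y) \<le>
  \<delta>(w) + 1, and a vertex at distance d from w forces d \<le> 2 \<delta>(w) + 1 + m div 2.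
  Equality has to be carried through the induction, but a presentation as a cycle with arms is not
  unique: equal arms can be exchanged, and for odd m a cycle vertex has two opposite vertices. The
  equality part therefore claims only that some list presents the cycle, and reflections of the list
  pass from one presentation to another.\<close>

definition adj :: "'a ugraph \<Rightarrow> 'a rel" where
  "adj G = {(x, y). x \<in> verts G \<and> y \<in> verts G \<and> {x, y} \<in> edges G}"

lemma sym_adj: "sym (adj G)"
  by (auto simp: adj_def sym_def insert_commute)

lemma walk_single: "u \<in> verts G \<Longrightarrow> walk G u [u] u"
  by (simp add: walk_def)

lemma walk_snoc:
  assumes "walk G u xs v" "{v, w} \<in> edges G" "w \<in> verts G"
  shows "walk G u (xs @ [w]) w"
  using assms by (auto simp: walk_def successively_append_iff)

lemma walk_butlast:
  assumes "walk G u (xs @ [w]) v" "xs \<noteq> []"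
  shows "walk G u xs (last xs) \<and> {last xs, w} \<in> edges G \<and> last xs \<in> verts G \<and> w = v"
  using assms by (auto simp: walk_def successively_append_iff)

lemma walk_rev: "walk G u xs v \<Longrightarrow> walk G v (rev xs) u"
  by (auto simp: walk_def hd_rev last_rev insert_commute)

lemma walk_imp_rtrancl: "walk G u xs v \<Longrightarrow> (u, v) \<in> (adj G)\<^sup>*"
proof (induction xs arbitrary: v rule: rev_induct)
  case Nil
  then show ?case by (simp add: walk_def)
next
  case (snoc w xs)
  show ?case
  proof (cases "xs = []")
    case True
    then show ?thesis using snoc.prems by (auto simp: walk_def)
  next
    case False
    note w = walk_butlast[OF snoc.prems False]
    moreover have "v \<in> verts G" using snoc.prems by (auto simp: walk_def)
    ultimately have "(last xs, v) \<in> adj G" by (auto simp: adj_def)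
    with w snoc.IH show ?thesis by (meson rtrancl.rtrancl_into_rtrancl)
  qed
qed

lemma walk_prefix:
  assumes "walk G u (ys @ w # zs) v"
  shows "walk G u (ys @ [w]) w"
proof -
  have "walk G u ((ys @ [w]) @ zs) v" using assms by simp
  moreover have "hd ((ys @ [w]) @ zs) = hd (ys @ [w])" by (rule hd_append2) simp
  ultimately show ?thesis unfolding walk_def successively_append_iff by simp
qed

text \<open>A walk that returns to \<open>z\<close> is cut at the earlier visit of \<open>z\<close>,
  so no repetition arises. Distinctness is what later allows a path to be closed up to a
  cycle.\<close>

lemma rtrancl_imp_distinct_walk:
  assumes "(u, v) \<in> (adj G)\<^sup>*" "u \<in> verts G"
  shows "\<exists>xs. walk G u xs v \<and> distinct xs"
  using assms
proof (induction rule: rtrancl_induct)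
  case base
  then show ?case by (metis walk_single distinct_singleton)
next
  case (step y z)
  then obtain xs where xs: "walk G u xs y" "distinct xs" by blast
  show ?case
  proof (cases "z \<in> set xs")
    case True
    then obtain as bs where s: "xs = as @ z # bs" by (meson split_list)
    then have "walk G u (as @ [z]) z" using xs walk_prefix by metis
    moreover have "distinct (as @ [z])" using xs s by auto
    ultimately show ?thesis by blast
  next
    case False
    have "walk G u (xs @ [z]) z"
      using step xs by (intro walk_snoc) (auto simp: adj_def)
    moreover have "distinct (xs @ [z])" using xs False by auto
    ultimately show ?thesis by blast
  qed
qed

lemma walk_iff_rtrancl:
  "u \<in> verts G \<Longrightarrow> (\<exists>xs. walk G u xs v) \<longleftrightarrow> (u, v) \<in> (adj G)\<^sup>*"
  by (meson rtrancl_imp_distinct_walk walk_imp_rtrancl)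

lemma connected_graphI:
  assumes "s \<in> verts G" "\<And>x. x \<in> verts G \<Longrightarrow> (s, x) \<in> (adj G)\<^sup>*"
  shows "connected_graph G"
  unfolding connected_graph_def
proof (intro conjI ballI)
  show "verts G \<noteq> {}" using assms by auto
  fix u v assume "u \<in> verts G" "v \<in> verts G"
  then have "(u, s) \<in> (adj G)\<^sup>*" "(s, v) \<in> (adj G)\<^sup>*"
    using assms sym_rtrancl[OF sym_adj[of G]] by (auto dest: symD)
  then show "\<exists>xs. walk G u xs v" using \<open>u \<in> verts G\<close> by (simp add: walk_iff_rtrancl)
qed

lemma connected_graphD:
  "connected_graph G \<Longrightarrow> u \<in> verts G \<Longrightarrow> v \<in> verts G \<Longrightarrow> (u, v) \<in> (adj G)\<^sup>*"
  using walk_iff_rtrancl unfolding connected_graph_def by metis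

lemma gdist_sym: "gdist G u v = gdist G v u"
proof -
  have "(\<exists>xs. walk G u xs v \<and> length xs = k) \<longleftrightarrow> (\<exists>xs. walk G v xs u \<and> length xs = k)" for k
    by (metis length_rev walk_rev)
  then show ?thesis by (simp add: gdist_def)
qed

lemma gdist_le: "walk G u xs v \<Longrightarrow> length xs = Suc k \<Longrightarrow> gdist G u v \<le> k"
  unfolding gdist_def by (rule Least_le) blast

lemma gdist_walk:
  assumes "connected_graph G" "u \<in> verts G" "v \<in> verts G"
  obtains xs where "walk G u xs v" "length xs = Suc (gdist G u v)"
proof -
  obtain xs where "walk G u xs v" using assms by (auto simp: connected_graph_def)
  moreover from this have "length xs = Suc (length xs - 1)" by (cases xs) (auto simp: walk_def)
  ultimately have "\<exists>k xs. walk G u xs v \<and> length xs = Suc k" by blast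
  then have "\<exists>xs. walk G u xs v \<and> length xs = Suc (gdist G u v)"
    unfolding gdist_def by (rule LeastI_ex)
  then show thesis using that by blast
qed

lemma gdist_self [simp]: "u \<in> verts G \<Longrightarrow> gdist G u u = 0"
  using gdist_le[OF walk_single, of u G 0] by simp

lemma gdist_eq_0D:
  assumes "connected_graph G" "u \<in> verts G" "v \<in> verts G" "gdist G u v = 0"
  shows "u = v"
proof -
  obtain xs where "walk G u xs v" "length xs = Suc 0" using gdist_walk assms by metis
  then show ?thesis by (cases xs) (auto simp: walk_def)
qed

lemma gdist_edge:
  assumes "connected_graph G" "u \<in> verts G" "v \<in> verts G" "w \<in> verts G" "{v, w} \<in> edges G"
  shows "gdist G u w \<le> Suc (gdist G u v)"
proof -
  obtain xs where "walk G u xs v" "length xs = Suc (gdist G u v)" using gdist_walk assms by metis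
  with assms show ?thesis by (intro gdist_le[of _ _ "xs @ [w]"] walk_snoc) auto
qed

lemma gdist_pred:
  assumes "connected_graph G" "u \<in> verts G" "v \<in> verts G" "gdist G u v = Suc k"
  obtains y where "y \<in> verts G" "{y, v} \<in> edges G" "gdist G u y = k"
proof -
  obtain xs where xs: "walk G u xs v" "length xs = Suc (Suc k)" using gdist_walk assms by metis
  then obtain ys z where ys: "xs = ys @ [z]" by (metis append_butlast_last_id walk_def)
  then have ne: "ys \<noteq> []" using xs by auto
  note w = walk_butlast[OF xs(1)[unfolded ys] ne]
  then have "gdist G u (last ys) \<le> k" using xs ys by (intro gdist_le) auto
  moreover have "Suc k \<le> Suc (gdist G u (last ys))"
    using gdist_edge[OF assms(1,2), of "last ys" v] w assms by metis
  ultimately show thesis using that w by auto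
qed

section \<open>Distances certified by a potential\<close>

lemma descending_walk:
  fixes f :: "'a \<Rightarrow> nat"
  assumes zero: "\<And>x. x \<in> verts G \<Longrightarrow> f x = 0 \<Longrightarrow> x = s"
    and desc: "\<And>x k. x \<in> verts G \<Longrightarrow> f x = Suc k \<Longrightarrow> \<exists>y\<in>verts G. {y, x} \<in> edges G \<and> f y = k"
    and "x \<in> verts G"
  shows "\<exists>xs. walk G s xs x \<and> length xs = Suc (f x)"
  using \<open>x \<in> verts G\<close>
proof (induction "f x" arbitrary: x)
  case 0
  then have "x = s" by (simp add: zero)
  then show ?case using 0 by (metis length_Cons list.size(3) walk_single)
next
  case (Suc k)
  then obtain y where y: "y \<in> verts G" "{y, x} \<in> edges G" "f y = k" using desc by metis
  then obtain xs where "walk G s xs y" "length xs = Suc k" using Suc by blast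
  then have "walk G s (xs @ [x]) x" "length (xs @ [x]) = Suc (f x)"
    using Suc y walk_snoc by auto
  then show ?case by blast
qed

text \<open>A certificate for distances: a function growing by at most one per edge stays below the
  number of steps of any walk from \<open>s\<close>, and descending it yields a walk of exactly
  \<open>f x\<close> steps. It gives the distances after attaching a leaf as well as those on a
  cycle.\<close>

lemma gdist_eqI:
  fixes f :: "'a \<Rightarrow> nat"
  assumes "f s = 0"
    and zero: "\<And>x. x \<in> verts G \<Longrightarrow> f x = 0 \<Longrightarrow> x = s"
    and lip: "\<And>x y. x \<in> verts G \<Longrightarrow> y \<in> verts G \<Longrightarrow> {x, y} \<in> edges G \<Longrightarrow> f y \<le> Suc (f x)"
    and desc: "\<And>x k. x \<in> verts G \<Longrightarrow> f x = Suc k \<Longrightarrow> \<exists>y\<in>verts G. {y, x} \<in> edges G \<and> f y = k"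
    and x: "x \<in> verts G"
  shows "gdist G s x = f x"
proof -
  have low: "f y < length xs" if "walk G s xs y" for xs y
    using that
  proof (induction xs arbitrary: y rule: rev_induct)
    case Nil
    then show ?case by (simp add: walk_def)
  next
    case (snoc z xs)
    show ?case
    proof (cases "xs = []")
      case True
      then show ?thesis using snoc.prems \<open>f s = 0\<close> by (auto simp: walk_def)
    next
      case False
      note w = walk_butlast[OF snoc.prems False]
      moreover have "y \<in> verts G" using snoc.prems by (auto simp: walk_def)
      ultimately have "f y \<le> Suc (f (last xs))" by (intro lip) auto
      then show ?thesis using snoc.IH w by fastforce
    qed
  qed
  obtain xs where xs: "walk G s xs x" "length xs = Suc (f x)"
    using descending_walk[OF zero desc x] by blast
  show ?thesis unfolding gdist_def
  proof (rule Least_equality)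
    show "\<exists>xs. walk G s xs x \<and> length xs = Suc (f x)" using xs by blast
    show "f x \<le> k" if "\<exists>xs. walk G s xs x \<and> length xs = Suc k" for k
      using that low by (metis less_Suc_eq_le)
  qed
qed

section \<open>The diameter as an attained maximum\<close>

lemma finite_gdist_set:
  "finite (verts G) \<Longrightarrow> finite {gdist G u v | u v. u \<in> verts G \<and> v \<in> verts G}"
  by (rule finite_subset[of _ "(\<lambda>(u, v). gdist G u v) ` (verts G \<times> verts G)"]) auto

lemma gdist_le_diameter:
  "finite (verts G) \<Longrightarrow> u \<in> verts G \<Longrightarrow> v \<in> verts G \<Longrightarrow> gdist G u v \<le> diameter G"
  unfolding diameter_def by (intro Max_ge finite_gdist_set) auto

lemma diameter_attained:
  assumes "finite (verts G)" "verts G \<noteq> {}"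
  obtains u v where "u \<in> verts G" "v \<in> verts G" "gdist G u v = diameter G"
proof -
  have "diameter G \<in> {gdist G u v | u v. u \<in> verts G \<and> v \<in> verts G}"
    unfolding diameter_def using assms by (intro Max_in finite_gdist_set) auto
  then show thesis using that by auto
qed

section \<open>Attaching a leaf\<close>

definition add_leaf :: "'a ugraph \<Rightarrow> 'a \<Rightarrow> 'a \<Rightarrow> 'a ugraph" where
  "add_leaf G v w = \<lparr>verts = insert v (verts G), edges = insert {v, w} (edges G)\<rparr>"

lemma verts_add_leaf [simp]: "verts (add_leaf G v w) = insert v (verts G)"
  and edges_add_leaf [simp]: "edges (add_leaf G v w) = insert {v, w} (edges G)"
  by (simp_all add: add_leaf_def)

lemma add_leaf_commute: "add_leaf (add_leaf G v w) x y = add_leaf (add_leaf G x y) v w"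
  by (simp add: add_leaf_def insert_commute)

lemma simple_graph_add_leaf:
  "simple_graph G \<Longrightarrow> w \<in> verts G \<Longrightarrow> v \<notin> verts G \<Longrightarrow> simple_graph (add_leaf G v w)"
  by (auto simp: simple_graph_def card_insert_if)

locale leaf_attachment =
  fixes G :: "'a ugraph" and v w :: 'a
  assumes simple: "simple_graph G" and conn: "connected_graph G"
    and w: "w \<in> verts G" and v: "v \<notin> verts G"
begin

abbreviation "H \<equiv> add_leaf G v w"

lemma fin [simp]: "finite (verts G)"
  and edge_verts: "e \<in> edges G \<Longrightarrow> e \<subseteq> verts G"
  using simple by (auto simp: simple_graph_def)

lemma fin_edges: "finite (edges G)"
  by (rule finite_subset[of _ "Pow (verts G)"]) (use edge_verts in \<open>auto simp: subset_iff\<close>)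

text \<open>A vertex with a single neighbour opens no shortcut: the potential that places
  \<open>v\<close> one step behind \<open>w\<close> meets the conditions of
  \<open>gdist_eqI\<close>.\<close>

lemma gdist_old:
  assumes "x \<in> verts G" "y \<in> verts G"
  shows "gdist H x y = gdist G x y"
proof -
  let ?f = "\<lambda>y. if y = v then Suc (gdist G x w) else gdist G x y"
  have "gdist H x y = ?f y"
  proof (rule gdist_eqI)
    show "?f x = 0" using assms v by auto
    show "z = x" if "z \<in> verts H" "?f z = 0" for z
      using that gdist_eq_0D[OF conn, of x z] assms by (auto split: if_splits)
    show "?f b \<le> Suc (?f a)" if "a \<in> verts H" "b \<in> verts H" "{a, b} \<in> edges H" for a b
    proof (cases "{a, b} = {v, w}")
      case True
      then show ?thesis by (auto simp: doubleton_eq_iff)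
    next
      case False
      then have "{a, b} \<in> edges G" using that by auto
      then have "a \<in> verts G" "b \<in> verts G" "{a, b} \<in> edges G" using edge_verts by auto
      then show ?thesis using gdist_edge[OF conn] assms v by auto
    qed
    show "\<exists>b\<in>verts H. {b, a} \<in> edges H \<and> ?f b = k" if "a \<in> verts H" "?f a = Suc k" for a k
    proof (cases "a = v")
      case True
      then show ?thesis using that w v by (intro bexI[of _ w]) auto
    next
      case False
      then have "a \<in> verts G" "gdist G x a = Suc k" using that by auto
      then obtain b where "b \<in> verts G" "{b, a} \<in> edges G" "gdist G x b = k"
        using gdist_pred[OF conn assms(1)] by metis
      then show ?thesis using v by (intro bexI[of _ b]) auto
    qed
    show "y \<in> verts H" using assms by auto
  qed
  then show ?thesis using assms v by auto
qed

lemma conn_H: "connected_graph H"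
proof (rule connected_graphI)
  show "w \<in> verts H" using w by simp
  fix x assume x: "x \<in> verts H"
  show "(w, x) \<in> (adj H)\<^sup>*"
  proof (cases "x = v")
    case True
    then show ?thesis using w by (intro r_into_rtrancl) (auto simp: adj_def insert_commute)
  next
    case False
    have "(adj G)\<^sup>* \<subseteq> (adj H)\<^sup>*" by (rule rtrancl_mono) (auto simp: adj_def)
    then show ?thesis using connected_graphD[OF conn w, of x] x False by auto
  qed
qed

lemma simple_H: "simple_graph H"
  using simple w v by (rule simple_graph_add_leaf)

lemma gdist_old_new:
  assumes "x \<in> verts G"
  shows "gdist H x v = Suc (gdist G x w)"
proof (rule antisym)
  show "gdist H x v \<le> Suc (gdist G x w)"
    using gdist_edge[OF conn_H, of x w v] gdist_old[of x w] assms w by (simp add: insert_commute)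
  have "gdist H x v \<noteq> 0" using gdist_eq_0D[OF conn_H, of x v] assms v by auto
  then obtain k where k: "gdist H x v = Suc k" using not0_implies_Suc by blast
  then obtain y where y: "y \<in> verts H" "{y, v} \<in> edges H" "gdist H x y = k"
    using gdist_pred[OF conn_H, of x v k] assms by auto
  have "{y, v} \<notin> edges G" using edge_verts v by auto
  then have "y = w" using y w v by (auto simp: doubleton_eq_iff)
  then show "Suc (gdist G x w) \<le> gdist H x v" using k y gdist_old assms w by simp
qed

lemma gdist_new_old: "x \<in> verts G \<Longrightarrow> gdist H v x = Suc (gdist G w x)"
  using gdist_old_new gdist_sym by metis

lemma degree_new: "degree H v = 1"
proof -
  have "{e \<in> edges H. v \<in> e} = {{v, w}}" using edge_verts v by auto
  then show ?thesis by (simp add: degree_def)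
qed

lemma degree_old: "x \<in> verts G \<Longrightarrow> degree H x = degree G x + (if x = w then 1 else 0)"
proof -
  assume x: "x \<in> verts G"
  have "{v, w} \<notin> edges G" using edge_verts v by auto
  moreover have "{e \<in> edges H. x \<in> e} = (if x = w then insert {v, w} else id) {e \<in> edges G. x \<in> e}"
    using x v by auto
  ultimately show ?thesis using fin_edges by (simp add: degree_def)
qed

lemma sum_verts_H: "(\<Sum>x\<in>verts H. g x) = g v + (\<Sum>x\<in>verts G. g x)"
  using v by simp

lemma card_H: "card (verts H) = Suc (card (verts G))"
  using v by simp

lemma dist_sum_new: "dist_sum H v = dist_sum G w + card (verts G)"
proof -
  have "dist_sum H v = (\<Sum>y\<in>verts G. gdist H v y)"
    unfolding dist_sum_def sum_verts_H by simp
  also have "\<dots> = (\<Sum>y\<in>verts G. gdist G w y + 1)"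
    by (intro sum.cong) (auto simp: gdist_new_old)
  also have "\<dots> = (\<Sum>y\<in>verts G. gdist G w y) + (\<Sum>y\<in>verts G. 1)"
    by (rule sum.distrib)
  finally show ?thesis by (simp add: dist_sum_def)
qed

lemma dist_sum_old: "x \<in> verts G \<Longrightarrow> dist_sum H x = dist_sum G x + gdist G x w + 1"
  unfolding dist_sum_def sum_verts_H by (simp add: gdist_old gdist_old_new)

text \<open>Only pairs containing \<open>v\<close> can raise the diameter, and their distance
  exceeds that of a pair containing \<open>w\<close> by one. So the growth is at most one, and then
  \<open>w\<close> is an end of a diametral path.\<close>

lemma diameter_cases:
  "diameter H = diameter G \<or>
   diameter H = Suc (diameter G) \<and> (\<exists>y\<in>verts G. gdist G w y = diameter G)"
proof -
  obtain a b where ab: "a \<in> verts G" "b \<in> verts G" "gdist G a b = diameter G"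
    using diameter_attained[of G] w fin by blast
  then have ge: "diameter G \<le> diameter H"
    using gdist_le_diameter[of H a b] by (simp add: gdist_old)
  obtain x y where xy: "x \<in> verts H" "y \<in> verts H" "gdist H x y = diameter H"
    using diameter_attained[of H] by auto
  have new: ?thesis if "z \<in> verts G" "Suc (gdist G w z) = diameter H" for z
    using that ge gdist_le_diameter[of G w z] w by (metis fin le_SucE le_antisym order_refl Suc_inject)
  consider "x = v" "y = v" | "x = v" "y \<in> verts G" | "x \<in> verts G" "y = v" | "x \<in> verts G" "y \<in> verts G"
    using xy by auto
  then show ?thesis
  proof cases
    case 1
    then show ?thesis using xy ge by simp
  next
    case 2
    then show ?thesis using xy gdist_new_old new by simp
  next
    case 3
    then show ?thesis using xy gdist_old_new new gdist_sym by metis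
  next
    case 4
    then show ?thesis using xy ge gdist_old gdist_le_diameter[of G x y] by simp
  qed
qed

end

section \<open>Cycles\<close>

definition cycle_graph :: "'a list \<Rightarrow> 'a ugraph" where
  "cycle_graph xs = \<lparr>verts = set xs, edges = cycle_edges xs\<rparr>"

lemma verts_cycle_graph [simp]: "verts (cycle_graph xs) = set xs"
  and edges_cycle_graph [simp]: "edges (cycle_graph xs) = cycle_edges xs"
  by (simp_all add: cycle_graph_def)

lemma Suc_mod_if: "i < n \<Longrightarrow> Suc i mod n = (if Suc i = n then 0 else Suc i)"
  by auto

text \<open>The index map i -> j - i modulo the length. Being an involution, it turns one inclusion
  into an equality. It covers moving any vertex to the front (\<open>j\<close> its index),
  exchanging the two attachment vertices (\<open>j = m div 2\<close>) and reversing the direction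
  around a fixed front (\<open>j = 0\<close>).\<close>

definition reflect :: "nat \<Rightarrow> 'a list \<Rightarrow> 'a list" where
  "reflect j xs = map (\<lambda>i. xs ! (if i \<le> j then j - i else j + length xs - i)) [0..<length xs]"

lemma length_reflect [simp]: "length (reflect j xs) = length xs"
  by (simp add: reflect_def)

lemma nth_reflect:
  "i < length xs \<Longrightarrow> reflect j xs ! i = xs ! (if i \<le> j then j - i else j + length xs - i)"
  by (simp add: reflect_def)

lemma reflect_reflect: "j < length xs \<Longrightarrow> reflect j (reflect j xs) = xs"
  by (rule nth_equalityI) (auto simp: nth_reflect)

lemma set_reflect [simp]: "j < length xs \<Longrightarrow> set (reflect j xs) = set xs"
proof -
  assume j: "j < length xs"
  have "set (reflect j ys) \<subseteq> set ys" if "j < length ys" for ys :: "'a list"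
    using that by (auto simp: reflect_def)
  from this[of xs] this[of "reflect j xs"] j show ?thesis by (simp add: reflect_reflect)
qed

lemma distinct_reflect: "distinct xs \<Longrightarrow> j < length xs \<Longrightarrow> distinct (reflect j xs)"
  by (metis set_reflect length_reflect card_distinct distinct_card)

lemma cycle_edges_reflect: "j < length xs \<Longrightarrow> cycle_edges (reflect j xs) = cycle_edges xs"
proof -
  assume j: "j < length xs"
  have "cycle_edges (reflect j ys) \<subseteq> cycle_edges ys" if j: "j < length ys" for ys :: "'a list"
  proof
    fix e assume "e \<in> cycle_edges (reflect j ys)"
    then obtain i where i: "i < length ys" "e = {reflect j ys ! i, reflect j ys ! (Suc i mod length ys)}"
      by (auto simp: cycle_edges_def)
    \<comment> \<open>The reflection reverses orientation: the \<open>i\<close>-th edge of the new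
      list is the edge of \<open>ys\<close> starting at \<open>k\<close>, the old index of its
      second endpoint. After the last position that endpoint is the new front, with old index
      \<open>j\<close>.\<close>
    define k where "k = (if Suc i = length ys then j else if Suc i \<le> j then j - Suc i else j + length ys - Suc i)"
    have ne: "ys \<noteq> []" using j by auto
    have k: "k < length ys" using i j by (auto simp: k_def)
    have "reflect j ys ! (Suc i mod length ys) = ys ! k"
      using i j ne nth_reflect[of 0 ys j] by (cases "Suc i = length ys") (auto simp: k_def nth_reflect)
    moreover have "(if i \<le> j then j - i else j + length ys - i) = Suc k mod length ys"
      using i j k by (auto simp: k_def Suc_mod_if)
    then have "reflect j ys ! i = ys ! (Suc k mod length ys)"
      using i by (simp add: nth_reflect)
    ultimately show "e \<in> cycle_edges ys" using i k by (auto simp: cycle_edges_def)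
  qed
  from this[of xs] this[of "reflect j xs"] j show ?thesis by (simp add: reflect_reflect)
qed

lemma cycle_graph_reflect: "j < length xs \<Longrightarrow> cycle_graph (reflect j xs) = cycle_graph xs"
  by (simp add: cycle_graph_def cycle_edges_reflect)

text \<open>From \<open>m\<close> to \<open>m + 2\<close> the summand 0 is split off and each of the
  other \<open>m + 1\<close> summands grows by one; the right side grows by \<open>m + 1\<close> for
  either parity.\<close>

lemma sum_min_cyclic: "(\<Sum>j<m::nat. min j (m - j)) = m * m div 4"
proof (induction m rule: nat_induct2)
  case (step m)
  have "(\<Sum>j<m+2. min j (m + 2 - j)) = (\<Sum>i<Suc m. min (Suc i) (m + 2 - Suc i))"
    by (simp only: add_2_eq_Suc' sum.lessThan_Suc_shift[of _ "Suc m"] min_0L add_0)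
  also have "\<dots> = (\<Sum>i<Suc m. min i (m - i) + 1)"
    by (intro sum.cong) auto
  also have "\<dots> = (\<Sum>i<m. min i (m - i)) + (m + 1)"
    by (simp add: sum_Suc)
  also have "\<dots> = m * m div 4 + (m + 1)" by (simp only: step)
  also have "\<dots> = (m * m + (m + 1) * 4) div 4" by simp
  also have "m * m + (m + 1) * 4 = (m + 2) * (m + 2)" by algebra
  finally show ?case .
qed auto

section \<open>Degrees, distances and levels on a single cycle\<close>

locale cycle_list =
  fixes xs :: "'a list"
  assumes dist: "distinct xs" and len: "3 \<le> length xs"
begin

abbreviation "m \<equiv> length xs"

lemma Suc_mod_less: "Suc l mod m < m"
  by (rule mod_less_divisor) (use len in linarith)

lemma not_Nil [simp]: "xs \<noteq> []"
  using len by auto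

lemma nth_eq_iff: "i < m \<Longrightarrow> j < m \<Longrightarrow> xs ! i = xs ! j \<longleftrightarrow> i = j"
  using dist nth_eq_iff_index_eq by blast

lemma cycle_edges_image: "cycle_edges xs = (\<lambda>i. {xs ! i, xs ! (Suc i mod m)}) ` {..<m}"
  by (auto simp: cycle_edges_def)

lemma cycle_edge_iff:
  assumes "i < m" "j < m"
  shows "{xs ! i, xs ! j} \<in> cycle_edges xs \<longleftrightarrow> j = Suc i mod m \<or> i = Suc j mod m"
proof -
  note * = Suc_mod_less
  have "{xs ! i, xs ! j} \<in> cycle_edges xs \<longleftrightarrow>
    (\<exists>l<m. (i = l \<and> j = Suc l mod m) \<or> (i = Suc l mod m \<and> j = l))"
    using assms * by (auto simp: cycle_edges_def doubleton_eq_iff nth_eq_iff)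
  then show ?thesis using assms by auto
qed

lemma card_cycle_edges: "card (cycle_edges xs) = m"
proof -
  note * = Suc_mod_less
  have "inj_on (\<lambda>i. {xs ! i, xs ! (Suc i mod m)}) {..<m}"
  proof (rule inj_onI)
    fix i j assume ij: "i \<in> {..<m}" "j \<in> {..<m}"
      "{xs ! i, xs ! (Suc i mod m)} = {xs ! j, xs ! (Suc j mod m)}"
    show "i = j"
    proof (rule ccontr)
      assume "i \<noteq> j"
      then have "i = Suc j mod m" "j = Suc i mod m"
        using ij * by (auto simp: doubleton_eq_iff nth_eq_iff)
      moreover have "i < m" "j < m" using ij by auto
      ultimately show False using len by (auto simp: Suc_mod_if split: if_splits)
    qed
  qed
  then show ?thesis unfolding cycle_edges_image by (simp add: card_image)
qed

lemma cycle_edge_subset: "e \<in> cycle_edges xs \<Longrightarrow> e \<subseteq> set xs \<and> card e = 2"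
proof -
  have *: "Suc l mod m < m" "l < m \<Longrightarrow> Suc l mod m \<noteq> l" for l
    using len Suc_mod_less by (auto simp: Suc_mod_if)
  assume "e \<in> cycle_edges xs"
  then obtain i where i: "i < m" "e = {xs ! i, xs ! (Suc i mod m)}" by (auto simp: cycle_edges_def)
  have "xs ! i \<noteq> xs ! (Suc i mod m)" using * i nth_eq_iff by metis
  then show ?thesis using i * by auto
qed

lemma simple_cycle_graph: "simple_graph (cycle_graph xs)"
  using cycle_edge_subset by (auto simp: simple_graph_def)

lemma degree_cycle_graph:
  assumes "x \<in> set xs"
  shows "degree (cycle_graph xs) x = 2"
proof -
  obtain i where i: "i < m" "x = xs ! i" using assms by (metis in_set_conv_nth)
  define j where "j = (if i = 0 then m - 1 else i - 1)"
  have j: "j < m" "j \<noteq> i" "Suc j mod m = i" using i len by (auto simp: j_def)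
  note * = Suc_mod_less
  have **: "Suc l mod m = i \<longleftrightarrow> l = j" if "l < m" for l
    using that i by (auto simp: j_def Suc_mod_if split: if_splits)
  have "x \<in> {xs ! l, xs ! (Suc l mod m)} \<longleftrightarrow> l = i \<or> l = j" if "l < m" for l
    using i(1) j(1) **[OF that] that unfolding i(2) insert_iff by (simp add: nth_eq_iff Suc_mod_less eq_commute)
  then have "{e \<in> cycle_edges xs. x \<in> e} = (\<lambda>l. {xs ! l, xs ! (Suc l mod m)}) ` {i, j}"
    unfolding cycle_edges_image using i(1) j(1) by blast
  moreover have "{xs ! i, xs ! (Suc i mod m)} \<noteq> {xs ! j, xs ! (Suc j mod m)}"
    using i j * len by (auto simp: doubleton_eq_iff nth_eq_iff Suc_mod_if split: if_splits)
  ultimately show ?thesis by (simp add: degree_def)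
qed

definition pos where "pos x = inv_into {..<m} ((!) xs) x"

lemma pos_nth [simp]: "i < m \<Longrightarrow> pos (xs ! i) = i"
  unfolding pos_def using dist by (intro inv_into_f_f) (auto intro: inj_on_nth)

abbreviation "cdist i \<equiv> min i (m - i)"

lemma cdist_edge: "i < m \<Longrightarrow> cdist (Suc i mod m) \<le> Suc (cdist i) \<and> cdist i \<le> Suc (cdist (Suc i mod m))"
  by (auto simp: Suc_mod_if)

lemma cdist_desc:
  assumes "i < m" "cdist i = Suc k"
  shows "\<exists>j<m. {xs ! j, xs ! i} \<in> cycle_edges xs \<and> cdist j = k"
proof (cases "i \<le> m - i")
  case True
  then show ?thesis using assms by (intro exI[of _ "i - 1"]) (auto simp: cycle_edge_iff)
next
  case False
  have "Suc i mod m < m" by (rule Suc_mod_less)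
  moreover have "cdist (Suc i mod m) = k" using False assms by (auto simp: Suc_mod_if)
  ultimately show ?thesis using assms
    by (intro exI[of _ "Suc i mod m"]) (auto simp: cycle_edge_iff)
qed

text \<open>The shorter way round, read off the index, is the potential. Its descending walks also
  give connectedness, hence the joint proof.\<close>

lemma gdist_nth:
  shows "j < m \<Longrightarrow> gdist (cycle_graph xs) (xs ! 0) (xs ! j) = cdist j"
    and connected_cycle_graph: "connected_graph (cycle_graph xs)"
proof -
  let ?f = "\<lambda>x. cdist (pos x)"
  have f0: "?f (xs ! 0) = 0" using len by (subst pos_nth) auto
  have zero: "x = xs ! 0" if "x \<in> verts (cycle_graph xs)" "?f x = 0" for x
  proof -
    have "x \<in> set xs" using that by simp
    then obtain i where i: "i < m" "x = xs ! i" by (metis in_set_conv_nth)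
    then have "i = 0" using that i by simp
    with i show ?thesis by (simp only:)
  qed
  have desc: "\<exists>y\<in>verts (cycle_graph xs). {y, x} \<in> edges (cycle_graph xs) \<and> ?f y = k"
    if "x \<in> verts (cycle_graph xs)" "?f x = Suc k" for x k
  proof -
    have "x \<in> set xs" using that by simp
    then obtain i where i: "i < m" "x = xs ! i" by (metis in_set_conv_nth)
    then have "cdist i = Suc k" using that by simp
    then obtain j where "j < m" "{xs ! j, xs ! i} \<in> cycle_edges xs" "cdist j = k"
      using cdist_desc i by blast
    then show ?thesis using i by (intro bexI[of _ "xs ! j"]) auto
  qed
  have lip: "?f y \<le> Suc (?f x)" if "{x, y} \<in> edges (cycle_graph xs)" for x y
  proof -
    note * = Suc_mod_less
    have "{x, y} \<in> (\<lambda>i. {xs ! i, xs ! (Suc i mod m)}) ` {..<m}"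
      using that by (simp only: edges_cycle_graph cycle_edges_image)
    then obtain i where i: "{x, y} = {xs ! i, xs ! (Suc i mod m)}" "i \<in> {..<m}"
      by (rule imageE)
    from i(2) have im: "i < m" by simp
    note pos = pos_nth[OF im] pos_nth[OF Suc_mod_less[of i]]
      cdist_edge[OF im, THEN conjunct1] cdist_edge[OF im, THEN conjunct2]
    from i(1) consider "x = xs ! i" "y = xs ! (Suc i mod m)" | "y = xs ! i" "x = xs ! (Suc i mod m)"
      by (auto simp only: doubleton_eq_iff)
    then show ?thesis
      by cases (simp_all only: pos)
  qed
  show "gdist (cycle_graph xs) (xs ! 0) (xs ! j) = cdist j" if "j < m"
  proof -
    have "gdist (cycle_graph xs) (xs ! 0) (xs ! j) = ?f (xs ! j)"
      by (rule gdist_eqI) (use f0 zero lip desc that in \<open>assumption | simp\<close>)+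
    then show ?thesis using that by (simp only: pos_nth)
  qed
  show "connected_graph (cycle_graph xs)"
  proof (rule connected_graphI)
    have "0 < m" using len by auto
    then show "xs ! 0 \<in> verts (cycle_graph xs)" by simp
    show "(xs ! 0, x) \<in> (adj (cycle_graph xs))\<^sup>*" if "x \<in> verts (cycle_graph xs)" for x
    proof -
      have "\<exists>ws. walk (cycle_graph xs) (xs ! 0) ws x \<and> length ws = Suc (?f x)"
        by (rule descending_walk) (fact zero desc that)+
      then show ?thesis by (elim exE conjE) (rule walk_imp_rtrancl)
    qed
  qed
qed

lemma reroot:
  assumes "x \<in> set xs"
  obtains ys where "cycle_list ys" "cycle_graph ys = cycle_graph xs" "set ys = set xs"
    "length ys = m" "ys ! 0 = x"
proof -
  obtain j where j: "j < m" "x = xs ! j" using assms by (metis in_set_conv_nth)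
  moreover have "reflect j xs ! 0 = x" using j by (subst nth_reflect) auto
  moreover have "cycle_list (reflect j xs)"
    using j len dist by unfold_locales (auto simp: distinct_reflect)
  ultimately show thesis using that[of "reflect j xs"] by (simp add: cycle_graph_reflect)
qed

lemma gdist_cycle_le:
  assumes "x \<in> set xs" "y \<in> set xs"
  shows "gdist (cycle_graph xs) x y \<le> m div 2"
proof -
  obtain ys where ys: "cycle_list ys" "cycle_graph ys = cycle_graph xs" "set ys = set xs"
    "length ys = m" "ys ! 0 = x" using reroot assms by metis
  then obtain j where j: "j < m" "y = ys ! j" using assms by (metis in_set_conv_nth)
  then have "gdist (cycle_graph xs) x y = min j (m - j)"
    using cycle_list.gdist_nth(1)[OF ys(1)] ys by metis
  then show ?thesis by (simp add: min_def) presburger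
qed

text \<open>The two directions around the cycle reach the indices \<open>i\<close> and
  \<open>m - i\<close>, which differ because \<open>2 * i < m\<close>.\<close>

lemma card_cycle_level:
  assumes "x \<in> set xs" "1 \<le> i" "i \<le> (m - 1) div 2"
  shows "2 \<le> card {y \<in> set xs. gdist (cycle_graph xs) x y = i}"
proof -
  obtain ys where ys: "cycle_list ys" "cycle_graph ys = cycle_graph xs" "set ys = set xs"
    "length ys = m" "ys ! 0 = x" using reroot assms by metis
  have i: "i < m" "m - i < m" "i \<noteq> m - i" "i \<le> m - i" using assms len by auto
  have g: "gdist (cycle_graph xs) x (ys ! j) = min j (m - j)" if "j < m" for j
    using cycle_list.gdist_nth(1)[OF ys(1)] ys that by metis
  have "{ys ! i, ys ! (m - i)} \<subseteq> {y \<in> set xs. gdist (cycle_graph xs) x y = i}"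
    using i g[of i] g[of "m - i"] ys nth_mem[of i ys] nth_mem[of "m - i" ys] by auto
  then have "card {ys ! i, ys ! (m - i)} \<le> card {y \<in> set xs. gdist (cycle_graph xs) x y = i}"
    by (intro card_mono) auto
  moreover have "ys ! i \<noteq> ys ! (m - i)"
    using cycle_list.nth_eq_iff[OF ys(1), of i "m - i"] i ys by simp
  ultimately show ?thesis by simp
qed

lemma dist_sum_cycle:
  assumes "x \<in> set xs"
  shows "dist_sum (cycle_graph xs) x = m * m div 4"
proof -
  obtain ys where ys: "cycle_list ys" "cycle_graph ys = cycle_graph xs" "set ys = set xs"
    "length ys = m" "ys ! 0 = x" using reroot assms by metis
  have g: "gdist (cycle_graph xs) x (ys ! j) = min j (m - j)" if "j < m" for j
    using cycle_list.gdist_nth(1)[OF ys(1)] ys that by metis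
  have b: "bij_betw ((!) ys) {..<m} (set xs)"
    using ys bij_betw_nth[of ys "{..<m}" "set xs"] by (auto simp: cycle_list_def)
  have "dist_sum (cycle_graph xs) x = (\<Sum>j<m. gdist (cycle_graph xs) x (ys ! j))"
    unfolding dist_sum_def verts_cycle_graph by (rule sum.reindex_bij_betw[OF b, symmetric])
  also have "\<dots> = (\<Sum>j<m. min j (m - j))" by (intro sum.cong) (auto simp: g)
  finally show ?thesis by (simp add: sum_min_cyclic)
qed

end

section \<open>Unicyclic graphs grow from their cycle\<close>

text \<open>The function \<open>\<delta>\<close> is the distance to the cycle. It is fixed from the start, and leaves
  are attached in the order of increasing \<open>\<delta>\<close>.\<close>

inductive grown :: "'a list \<Rightarrow> ('a \<Rightarrow> nat) \<Rightarrow> 'a ugraph \<Rightarrow> bool" for xs \<delta> where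
  cycle: "\<forall>x\<in>set xs. \<delta> x = 0 \<Longrightarrow> grown xs \<delta> (cycle_graph xs)"
| leaf: "grown xs \<delta> G \<Longrightarrow> w \<in> verts G \<Longrightarrow> v \<notin> verts G \<Longrightarrow> \<delta> v = Suc (\<delta> w) \<Longrightarrow>
    \<forall>x\<in>verts G. \<delta> x \<le> \<delta> v \<Longrightarrow> grown xs \<delta> (add_leaf G v w)"

lemma cycle_edgesE:
  assumes "e \<in> cycle_edges ys"
  obtains i where "i < length ys" "e = {ys ! i, ys ! (Suc i mod length ys)}"
  using assms unfolding cycle_edges_def by blast

lemma cycle_edges_mono_cycles:
  assumes "cycle_edges ys \<in> cycles G"
  shows "cycle_edges ys \<subseteq> edges G"
  using assms by (auto simp: cycles_def)

text \<open>A path between two neighbours of \<open>v\<close> is closed up through \<open>v\<close>.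
  The second claim records that the new cycle really passes through \<open>v\<close>, which
  contradicts uniqueness if \<open>v\<close> lies off the given cycle.\<close>

lemma cycle_through_vertex:
  assumes "walk G a ps b" "distinct ps" "v \<notin> set ps" "v \<in> verts G" "a \<noteq> b"
    and "{v, a} \<in> edges G" "{v, b} \<in> edges G"
  shows "cycle_edges (v # ps) \<in> cycles G" and "{v, a} \<in> cycle_edges (v # ps)"
proof -
  have ps: "ps \<noteq> []" "hd ps = a" "last ps = b" "set ps \<subseteq> verts G"
    "successively (\<lambda>x y. {x, y} \<in> edges G) ps"
    using assms(1) by (auto simp: walk_def)
  have "length ps \<noteq> 1" using ps \<open>a \<noteq> b\<close> by (auto simp: length_Suc_conv)
  then have len: "3 \<le> length (v # ps)" using ps(1) by (cases ps; cases "tl ps") auto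
  have succ: "successively (\<lambda>x y. {x, y} \<in> edges G) (v # ps)"
    using ps assms by (auto simp: successively_Cons)
  have "cycle_edges (v # ps) \<subseteq> edges G"
  proof
    fix e assume "e \<in> cycle_edges (v # ps)"
    then obtain i where i: "i < length (v # ps)"
      "e = {(v # ps) ! i, (v # ps) ! (Suc i mod length (v # ps))}"
      by (rule cycle_edgesE)
    show "e \<in> edges G"
    proof (cases "Suc i = length (v # ps)")
      case True
      then have "(v # ps) ! i = b" using ps last_conv_nth[of "v # ps"] by auto
      then show ?thesis using True i assms by (simp add: insert_commute)
    next
      case False
      then show ?thesis using i succ by (auto simp: successively_conv_nth)
    qed
  qed
  then show "cycle_edges (v # ps) \<in> cycles G"
    unfolding cycles_def using len assms ps
    by (intro CollectI exI[of _ "v # ps"]) auto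
  show "{v, a} \<in> cycle_edges (v # ps)"
    unfolding cycle_edges_def using ps len by (auto intro!: exI[of _ 0] simp: hd_conv_nth)
qed

context cycle_list
begin

text \<open>A chord and the arc that it spans form a cycle. Uniqueness gives this cycle the edge set
  of \<open>xs\<close>, so the chord was an edge of the cycle already.\<close>

lemma edges_of_spanning_cycle:
  assumes "simple_graph G" "verts G = set xs" "cycles G = {cycle_edges xs}"
  shows "edges G = cycle_edges xs"
proof (rule antisym)
  show sub: "cycle_edges xs \<subseteq> edges G" using assms by (intro cycle_edges_mono_cycles) simp
  have chord: "{xs ! i, xs ! j} \<in> cycle_edges xs"
    if "i < j" "j < m" "{xs ! i, xs ! j} \<in> edges G" for i j
  proof (cases "j = Suc i")
    case True
    then show ?thesis using that by (simp add: cycle_edge_iff)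
  next
    case False
    define zs where "zs = drop i (take (Suc j) xs)"
    have len: "length zs = Suc j - i" using that by (simp add: zs_def)
    have nth: "zs ! l = xs ! (i + l)" if "l \<le> j - i" for l
      using that \<open>i < j\<close> \<open>j < m\<close> by (simp add: zs_def)
    have mem: "{xs ! i, xs ! j} \<in> cycle_edges zs"
      unfolding cycle_edges_def using len nth that
      by (auto intro!: exI[of _ "j - i"] simp: insert_commute Suc_diff_le)
    have "e \<in> edges G" if "e \<in> cycle_edges zs" for e
    proof -
      obtain l where l: "l < length zs" "e = {zs ! l, zs ! (Suc l mod length zs)}"
        using \<open>e \<in> cycle_edges zs\<close> by (rule cycle_edgesE)
      show ?thesis
      proof (cases "Suc l = length zs")
        case True
        then have "i + l = j" using len \<open>i < j\<close> by simp
        then have "e = {xs ! i, xs ! j}" using True l nth \<open>i < j\<close> by (auto simp: insert_commute)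
        then show ?thesis using \<open>{xs ! i, xs ! j} \<in> edges G\<close> by simp
      next
        case False
        then have "e = {xs ! (i + l), xs ! Suc (i + l)}" using l len nth by auto
        moreover have "Suc (i + l) < m" using l len False \<open>j < m\<close> by auto
        ultimately have "e \<in> cycle_edges xs" by (simp add: cycle_edge_iff)
        then show ?thesis using sub by blast
      qed
    qed
    moreover have "distinct zs" "set zs \<subseteq> verts G"
      using dist assms(2) set_drop_subset[of i "take (Suc j) xs"] set_take_subset[of "Suc j" xs]
      by (auto simp: zs_def)
    ultimately have "cycle_edges zs \<in> cycles G"
      unfolding cycles_def using len that False by (auto intro!: exI[of _ zs])
    then show ?thesis using mem assms(3) by simp
  qed
  show "edges G \<subseteq> cycle_edges xs"
  proof
    fix e assume e: "e \<in> edges G"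
    then obtain a b where ab: "e = {a, b}" "a \<noteq> b" "a \<in> set xs" "b \<in> set xs"
      using assms by (auto simp: simple_graph_def card_2_iff)
    then obtain i j where ij: "a = xs ! i" "b = xs ! j" "i < m" "j < m"
      by (metis in_set_conv_nth)
    then have "i < j \<or> j < i" using ab(2) by (metis linorder_neqE_nat)
    then show "e \<in> cycle_edges xs"
      using chord[of i j] chord[of j i] e ab ij by (auto simp: insert_commute)
  qed
qed

text \<open>Of \<open>\<delta>\<close> only the zero set and the descending neighbours are
  prescribed, since these survive the removal of a vertex with maximal \<open>\<delta>\<close>; a
  distance would have to be recomputed in the smaller graph.\<close>

lemma grown_of_unique_cycle:
  assumes "simple_graph G" "connected_graph G" "set xs \<subseteq> verts G" "cycles G = {cycle_edges xs}"
    and "\<And>x. x \<in> verts G \<Longrightarrow> \<delta> x = 0 \<longleftrightarrow> x \<in> set xs"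
    and "\<And>x k. x \<in> verts G \<Longrightarrow> \<delta> x = Suc k \<Longrightarrow> \<exists>y\<in>verts G. {y, x} \<in> edges G \<and> \<delta> y = k"
  shows "grown xs \<delta> G"
  using assms
proof (induction "card (verts G)" arbitrary: G rule: less_induct)
  case less
  note simple = less.prems(1) and conn = less.prems(2) and sub = less.prems(3)
    and cyc = less.prems(4) and zero = less.prems(5) and desc = less.prems(6)
  have fin: "finite (verts G)" and ev: "\<And>e. e \<in> edges G \<Longrightarrow> e \<subseteq> verts G \<and> card e = 2"
    using simple by (auto simp: simple_graph_def)
  show ?case
  proof (cases "verts G = set xs")
    case True
    then have "G = cycle_graph xs"
      using edges_of_spanning_cycle[OF simple True cyc] by (simp add: cycle_graph_def)
    then show ?thesis using zero sub by (auto intro: grown.cycle)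
  next
    case False
    have "Max (\<delta> ` verts G) \<in> \<delta> ` verts G" using fin sub by (intro Max_in) auto
    then obtain v where v1: "v \<in> verts G" "\<delta> v = Max (\<delta> ` verts G)" by auto
    then have v: "v \<in> verts G" "\<And>x. x \<in> verts G \<Longrightarrow> \<delta> x \<le> \<delta> v"
      using fin by auto
    obtain x where "x \<in> verts G" "x \<notin> set xs" using False sub by auto
    then have "\<delta> x \<noteq> 0" "\<delta> x \<le> \<delta> v" using zero v(2) by blast+
    then have "\<delta> v \<noteq> 0" by simp
    then obtain k where k: "\<delta> v = Suc k" using not0_implies_Suc by blast
    then obtain w where w: "w \<in> verts G" "{w, v} \<in> edges G" "\<delta> w = k"
      using desc[OF v(1) k] by auto
    have vxs: "v \<notin> set xs" using \<open>\<delta> v \<noteq> 0\<close> zero v by auto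
    have wv: "w \<noteq> v" using w k by auto
    define G' where "G' = \<lparr>verts = verts G - {v}, edges = {e \<in> edges G. v \<notin> e}\<rparr>"
    have G' [simp]: "verts G' = verts G - {v}" "edges G' = {e \<in> edges G. v \<notin> e}"
      by (simp_all add: G'_def)
    have simple': "simple_graph G'" using simple by (auto simp: simple_graph_def)
    have sub': "set xs \<subseteq> verts G'" using sub vxs by auto
    have "cycle_edges xs \<subseteq> edges G" using cyc by (intro cycle_edges_mono_cycles) simp
    then have ce': "cycle_edges xs \<subseteq> edges G'" using cycle_edge_subset vxs by auto
    \<comment> \<open>Descents avoid \<open>v\<close>, because the lower neighbour \<open>y\<close>
      satisfies \<delta> y < \<delta> x \<le> \<delta> v.\<close>
    have desc': "\<exists>y\<in>verts G'. {y, x} \<in> edges G' \<and> \<delta> y = j" if x: "x \<in> verts G'" "\<delta> x = Suc j" for x j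
    proof -
      have "x \<in> verts G" using x by simp
      then obtain y where y: "y \<in> verts G" "{y, x} \<in> edges G" "\<delta> y = j"
        using desc x(2) by blast
      then have "y \<noteq> v" using v(2)[of x] x by auto
      then show ?thesis using y x by auto
    qed
    have conn': "connected_graph G'"
    proof (rule connected_graphI)
      show "xs ! 0 \<in> verts G'" using sub' by (simp add: subset_iff)
      show "(xs ! 0, x) \<in> (adj G')\<^sup>*" if "x \<in> verts G'" for x
        using that
      proof (induction "\<delta> x" arbitrary: x)
        case 0
        then have "x \<in> set xs" using zero by auto
        then have "(xs ! 0, x) \<in> (adj (cycle_graph xs))\<^sup>*"
          using connected_graphD[OF connected_cycle_graph, of "xs ! 0" x] by simp
        moreover have "adj (cycle_graph xs) \<subseteq> adj G'"
          using sub' ce' by (auto simp: adj_def)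
        ultimately show ?case using rtrancl_mono by blast
      next
        case (Suc j)
        then obtain y where y: "y \<in> verts G'" "{y, x} \<in> edges G'" "\<delta> y = j" using desc' by metis
        then have "(xs ! 0, y) \<in> (adj G')\<^sup>*" using Suc by auto
        moreover have "(y, x) \<in> adj G'" using y Suc by (simp add: adj_def)
        ultimately show ?case by (rule rtrancl_into_rtrancl)
      qed
    qed
    \<comment> \<open>A second neighbour \<open>u\<close> is joined to \<open>w\<close> by a path in
      \<open>G'\<close>, and \<open>v\<close> closes it to a cycle through \<open>v\<close>, which
      lies off the unique cycle.\<close>
    have leaf: "u = w" if u: "{v, u} \<in> edges G" for u
    proof (rule ccontr)
      assume ne: "u \<noteq> w"
      have uv: "u \<noteq> v" "u \<in> verts G" using ev[OF u] by auto
      then obtain ps where ps: "walk G' u ps w" "distinct ps"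
        using connected_graphD[OF conn', of u w] rtrancl_imp_distinct_walk[of u w G'] w wv by auto
      then have "walk G u ps w" "v \<notin> set ps"
        by (auto simp: walk_def elim!: successively_mono)
      moreover have "{v, w} \<in> edges G" using w by (simp add: insert_commute)
      ultimately have "cycle_edges (v # ps) \<in> cycles G" "{v, u} \<in> cycle_edges (v # ps)"
        using cycle_through_vertex[of G u ps w v] ps(2) v(1) ne u by blast+
      then have "{v, u} \<in> cycle_edges xs" using cyc by simp
      then show False using cycle_edge_subset vxs by auto
    qed
    have eq: "G = add_leaf G' v w"
    proof (rule ugraph.equality)
      show "verts G = verts (add_leaf G' v w)" using v by auto
      have "e = {v, w}" if e: "e \<in> edges G" "v \<in> e" for e
      proof -
        obtain a b where "e = {a, b}" using ev[OF e(1)] by (auto simp: card_2_iff)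
        then have "\<exists>u. e = {v, u}" using e(2) by auto
        then show ?thesis using leaf e(1) by auto
      qed
      moreover have "{v, w} \<in> edges G" using w by (simp add: insert_commute)
      ultimately show "edges G = edges (add_leaf G' v w)"
        unfolding edges_add_leaf G' by blast
    qed simp
    have "cycles G' \<subseteq> cycles G" by (auto simp: cycles_def)
    moreover have "cycle_edges xs \<in> cycles G'"
      unfolding cycles_def using len dist sub' ce' by blast
    ultimately have cyc': "cycles G' = {cycle_edges xs}" using cyc by auto
    have "card (verts G') < card (verts G)" using card_Diff1_less[OF fin v(1)] by simp
    then have "grown xs \<delta> G'"
    proof (rule less.hyps)
      show "\<delta> x = 0 \<longleftrightarrow> x \<in> set xs" if "x \<in> verts G'" for x
        using zero that by simp
    qed (fact simple' conn' sub' cyc' desc')+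
    then have "grown xs \<delta> (add_leaf G' v w)"
      using w wv v k by (intro grown.leaf) auto
    then show ?thesis using eq by simp
  qed
qed

end

lemma unicyclic_imp_grown:
  assumes "unicyclic G"
  obtains xs \<delta> where "cycle_list xs" "length xs = girth G" "grown xs \<delta> G"
proof -
  have simple: "simple_graph G" and conn: "connected_graph G" and ex1: "\<exists>!C. C \<in> cycles G"
    using assms by (auto simp: unicyclic_def)
  then obtain C where C: "cycles G = {C}" by blast
  then have "C \<in> cycles G" by simp
  then obtain xs where xs: "C = cycle_edges xs" "3 \<le> length xs" "distinct xs" "set xs \<subseteq> verts G"
    unfolding cycles_def by blast
  interpret cycle_list xs using xs by unfold_locales
  define \<delta> where "\<delta> x = Min ((\<lambda>c. gdist G c x) ` set xs)" for x
  have le: "\<delta> x \<le> gdist G c x" if "c \<in> set xs" for c x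
    unfolding \<delta>_def using that by (intro Min_le) auto
  have att: "\<exists>c\<in>set xs. \<delta> x = gdist G c x" for x
  proof -
    have "\<delta> x \<in> (\<lambda>c. gdist G c x) ` set xs" unfolding \<delta>_def by (intro Min_in) auto
    then show ?thesis by auto
  qed
  have "grown xs \<delta> G"
  proof (rule grown_of_unique_cycle)
    show "\<delta> x = 0 \<longleftrightarrow> x \<in> set xs" if "x \<in> verts G" for x
    proof
      assume "\<delta> x = 0"
      with att obtain c where "c \<in> set xs" "gdist G c x = 0" by metis
      then show "x \<in> set xs" using gdist_eq_0D[OF conn, of c x] xs that by auto
    next
      assume "x \<in> set xs"
      then show "\<delta> x = 0" using le[of x x] that by simp
    qed
    show "\<exists>y\<in>verts G. {y, x} \<in> edges G \<and> \<delta> y = k" if x: "x \<in> verts G" "\<delta> x = Suc k" for x k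
    proof -
      obtain c where c: "c \<in> set xs" "gdist G c x = Suc k" using att x by metis
      then have "c \<in> verts G" using xs by auto
      then obtain y where y: "y \<in> verts G" "{y, x} \<in> edges G" "gdist G c y = k"
        using gdist_pred[OF conn _ x(1) c(2)] by metis
      \<comment> \<open>The step towards \<open>c\<close> brings \<open>\<delta>\<close> down to at
        most \<open>k\<close>; a nearest cycle vertex \<open>c'\<close> of \<open>y\<close> shows
        that it cannot go lower.\<close>
      obtain c' where c': "c' \<in> set xs" "\<delta> y = gdist G c' y" using att by metis
      have "Suc k \<le> gdist G c' x" using le[OF c'(1), of x] x by simp
      also have "\<dots> \<le> Suc (\<delta> y)" using gdist_edge[OF conn, of c' y x] c' xs y x by auto
      finally have "\<delta> y = k" using le[OF c(1), of y] y by simp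
      then show ?thesis using y by blast
    qed
  qed (use simple conn xs C in auto)
  moreover have "girth G = length xs"
    using C xs card_cycle_edges by (simp add: girth_def)
  ultimately show thesis using that cycle_list_axioms by metis
qed

section \<open>Levels around a vertex and degree sums of grown graphs\<close>

lemma level_nonempty:
  assumes "connected_graph G" "w \<in> verts G" "y \<in> verts G" "i \<le> gdist G w y"
  shows "\<exists>z\<in>verts G. gdist G w z = i"
  using assms(3,4)
proof (induction "gdist G w y" arbitrary: y)
  case 0
  then show ?case by auto
next
  case (Suc k)
  show ?case
  proof (cases "i = Suc k")
    case True
    then show ?thesis using Suc by metis
  next
    case False
    have "gdist G w y = Suc k" using Suc(2) by simp
    then obtain z where "z \<in> verts G" "gdist G w z = k"
      using gdist_pred[OF assms(1,2) Suc(3)] by blast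
    then show ?thesis using Suc False by auto
  qed
qed

lemma sum_shifted_interval: "2 * (\<Sum>i\<in>{a<..a+c}. i) = 2 * c * a + c * (c + 1)" for a c :: nat
proof (induction c)
  case (Suc c)
  have "{a<..a + Suc c} = insert (a + Suc c) {a<..a+c}" by auto
  then show ?case using Suc by simp
qed simp

context cycle_list
begin

lemma grown_basic:
  assumes "grown xs \<delta> G"
  shows "simple_graph G" "connected_graph G" "set xs \<subseteq> verts G" "\<And>x. x \<in> set xs \<Longrightarrow> \<delta> x = 0"
    "\<And>x. x \<in> verts G \<Longrightarrow> \<delta> x = 0 \<Longrightarrow> x \<in> set xs"
proof -
  have "simple_graph G \<and> connected_graph G \<and> set xs \<subseteq> verts G \<and> (\<forall>x\<in>set xs. \<delta> x = 0) \<and>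
    (\<forall>x\<in>verts G. \<delta> x = 0 \<longrightarrow> x \<in> set xs)"
    using assms
  proof induction
    case cycle
    then show ?case using simple_cycle_graph connected_cycle_graph by simp
  next
    case (leaf G w v)
    then interpret leaf_attachment G v w by unfold_locales auto
    show ?case using leaf simple_H conn_H by auto
  qed
  then show "simple_graph G" "connected_graph G" "set xs \<subseteq> verts G" "\<And>x. x \<in> set xs \<Longrightarrow> \<delta> x = 0"
    "\<And>x. x \<in> verts G \<Longrightarrow> \<delta> x = 0 \<Longrightarrow> x \<in> set xs"
    by auto
qed

lemma leaf_attachment_grown:
  "grown xs \<delta> G \<Longrightarrow> w \<in> verts G \<Longrightarrow> v \<notin> verts G \<Longrightarrow> leaf_attachment G v w"
  using grown_basic by unfold_locales auto

text \<open>Two vertices can always be joined via the cycle, where \<open>m div 2\<close> steps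
  suffice; a new leaf adds one to both sides of the estimate.\<close>

lemma gdist_grown_le:
  assumes "grown xs \<delta> G" "x \<in> verts G" "y \<in> verts G"
  shows "gdist G x y \<le> \<delta> x + \<delta> y + m div 2"
  using assms
proof (induction arbitrary: x y)
  case cycle
  then show ?case using gdist_cycle_le by simp
next
  case (leaf G w v)
  then interpret leaf_attachment G v w by (intro leaf_attachment_grown)
  have *: "gdist H v z \<le> \<delta> v + \<delta> z + m div 2" if "z \<in> verts G" for z
    using that leaf.IH[of w z] leaf by (simp add: gdist_new_old)
  consider "x = v" "y = v" | "x = v" "y \<in> verts G" | "x \<in> verts G" "y = v" | "x \<in> verts G" "y \<in> verts G"
    using leaf.prems by auto
  then show ?case
  proof cases
    case 3
    then show ?thesis using *[of x] gdist_sym[of H x v] by simp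
  next
    case 4
    then show ?thesis using leaf.IH by (simp add: gdist_old)
  qed (use * in auto)
qed

text \<open>From \<open>x\<close> the cycle is met after \<open>\<delta> x\<close> steps, and from
  there both directions around it contribute a vertex per level. A new leaf sees the levels of
  \<open>w\<close> one step later, in line with its \<open>\<delta>\<close>.\<close>

lemma card_level_grown:
  assumes "grown xs \<delta> G" "x \<in> verts G" "1 \<le> i" "i \<le> (m - 1) div 2"
  shows "2 \<le> card {y \<in> verts G. gdist G x y = \<delta> x + i}"
  using assms
proof (induction arbitrary: x)
  case cycle
  then show ?case using card_cycle_level by simp
next
  case (leaf G w v)
  then interpret leaf_attachment G v w by (intro leaf_attachment_grown)
  obtain z where z: "z \<in> verts G" "{y \<in> verts G. gdist G z y = \<delta> z + i} \<subseteq> {y \<in> verts H. gdist H x y = \<delta> x + i}"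
  proof (cases "x = v")
    case True
    have "{y \<in> verts G. gdist G w y = \<delta> w + i} \<subseteq> {y \<in> verts H. gdist H v y = \<delta> v + i}"
      using leaf.hyps by (auto simp: gdist_new_old)
    then show ?thesis using that[of w] w True by simp
  next
    case False
    then have "x \<in> verts G" using leaf.prems by simp
    moreover from this have "{y \<in> verts G. gdist G x y = \<delta> x + i} \<subseteq> {y \<in> verts H. gdist H x y = \<delta> x + i}"
      by (auto simp: gdist_old)
    ultimately show ?thesis using that[of x] by simp
  qed
  have "2 \<le> card {y \<in> verts G. gdist G z y = \<delta> z + i}" using leaf.IH z leaf.prems by simp
  also have "\<dots> \<le> card {y \<in> verts H. gdist H x y = \<delta> x + i}"
    by (intro card_mono z) simp
  finally show ?case .
qed

lemma card_edges_grown: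
  assumes "grown xs \<delta> G"
  shows "card (edges G) = card (verts G)"
  using assms
proof induction
  case cycle
  then show ?case using card_cycle_edges dist by (simp add: distinct_card)
next
  case (leaf G w v)
  then interpret leaf_attachment G v w by (intro leaf_attachment_grown)
  have "{v, w} \<notin> edges G" using edge_verts v by auto
  then show ?case using leaf fin_edges by simp
qed

lemma sum_degree_grown:
  assumes "grown xs \<delta> G"
  shows "(\<Sum>x\<in>verts G. degree G x) = 2 * card (verts G)"
  using assms
proof induction
  case cycle
  then show ?case by (simp add: degree_cycle_graph)
next
  case (leaf G w v)
  then interpret leaf_attachment G v w by (intro leaf_attachment_grown)
  have "(\<Sum>x\<in>verts H. degree H x) = 1 + (\<Sum>x\<in>verts G. degree G x + (if x = w then 1 else 0))"
    unfolding sum_verts_H degree_new by (simp only: degree_old cong: sum.cong)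
  then show ?case using leaf w by (simp add: sum.distrib)
qed

text \<open>Reduces a degree-weighted sum to a plain distance sum. A leaf \<open>v\<close> at
  \<open>w\<close>, seen from an old \<open>y\<close>, adds d(v, y) + d(w, y) = 2 d(v, y) - 1, and
  the missing 1 comes from the vertex count. Seen from the leaf itself all old distances are shifted
  by one, which costs the sum of the degrees.\<close>

lemma sum_degree_gdist_grown:
  assumes "grown xs \<delta> G" "y \<in> verts G"
  shows "(\<Sum>x\<in>verts G. degree G x * gdist G x y) + card (verts G) = 2 * dist_sum G y + m + 2 * \<delta> y"
  using assms
proof (induction arbitrary: y)
  case cycle
  have "(\<Sum>x\<in>set xs. degree (cycle_graph xs) x * gdist (cycle_graph xs) x y)
      = (\<Sum>x\<in>set xs. 2 * gdist (cycle_graph xs) y x)"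
    using gdist_sym by (intro sum.cong) (auto simp: degree_cycle_graph)
  then show ?case using cycle dist by (simp add: dist_sum_def sum_distrib_left distinct_card)
next
  case (leaf G w v)
  then interpret leaf_attachment G v w by (intro leaf_attachment_grown)
  have old: "(\<Sum>x\<in>verts H. degree H x * gdist H x z)
      = gdist H v z + ((\<Sum>x\<in>verts G. degree G x * gdist H x z) + gdist H w z)" for z
  proof -
    have "(\<Sum>x\<in>verts G. degree H x * gdist H x z)
        = (\<Sum>x\<in>verts G. degree G x * gdist H x z + (if x = w then gdist H x z else 0))"
      by (intro sum.cong) (auto simp: degree_old algebra_simps)
    then show ?thesis using w unfolding sum_verts_H degree_new by (simp add: sum.distrib)
  qed
  show ?case
  proof (cases "y = v")
    case True
    have "(\<Sum>x\<in>verts G. degree G x * gdist H x v)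
        = (\<Sum>x\<in>verts G. degree G x * gdist G x w + degree G x)"
      by (intro sum.cong) (auto simp: gdist_old_new)
    also have "\<dots> = (\<Sum>x\<in>verts G. degree G x * gdist G x w) + 2 * card (verts G)"
      using sum_degree_grown leaf.hyps(1) by (simp add: sum.distrib)
    finally show ?thesis using True old[of v] leaf.IH[OF w] leaf.hyps w
      by (simp only: card_H dist_sum_new) (simp add: gdist_old_new)
  next
    case False
    then have y: "y \<in> verts G" using leaf.prems by simp
    have "(\<Sum>x\<in>verts G. degree G x * gdist H x y) = (\<Sum>x\<in>verts G. degree G x * gdist G x y)"
      using y by (intro sum.cong) (auto simp: gdist_old)
    then show ?thesis using old[of y] leaf.IH[OF y] y w
      by (simp only: card_H dist_sum_old gdist_new_old gdist_old gdist_sym[of G y w]) simp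
  qed
qed

text \<open>Four copies of D(w) arise: one in the distance sum of the new leaf, one through the
  raised degree of \<open>w\<close>, and two from the increments d(x, w), weighted by degrees and
  evaluated with \<open>sum_degree_gdist_grown\<close>.\<close>

lemma degree_distance_leaf:
  assumes "grown xs \<delta> G" "w \<in> verts G" "v \<notin> verts G"
  shows "degree_distance (add_leaf G v w)
    = degree_distance G + 4 * dist_sum G w + 2 * card (verts G) + m + 2 * \<delta> w + 1"
proof -
  interpret leaf_attachment G v w using assms by (rule leaf_attachment_grown)
  have "(\<Sum>x\<in>verts G. degree H x * dist_sum H x)
      = (\<Sum>x\<in>verts G. (degree G x * dist_sum G x + degree G x * gdist G x w + degree G x)
          + (if x = w then dist_sum G w + 1 else 0))"
    using w by (intro sum.cong) (auto simp: degree_old dist_sum_old algebra_simps)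
  also have "\<dots> = degree_distance G + (\<Sum>x\<in>verts G. degree G x * gdist G x w)
      + 2 * card (verts G) + (dist_sum G w + 1)"
    using w sum_degree_grown[OF assms(1)] by (simp add: sum.distrib degree_distance_def)
  finally show ?thesis using sum_degree_gdist_grown[OF assms(1) w]
    unfolding degree_distance_def[of H] sum_verts_H degree_new dist_sum_new by simp
qed

text \<open>Each level up to \<open>d\<close> needs one vertex and the \<open>c\<close> levels
  beyond \<open>\<delta> w\<close> a second one, which accounts for \<open>d + 1 + c\<close>
  vertices. Every surplus vertex contributes at least 1 to the distance sum; this is the origin of
  the terms with \<open>card (verts G)\<close>. The bound is doubled and rearranged to avoid
  division and subtraction.\<close>

lemma dist_sum_grown_ge:
  assumes g: "grown xs \<delta> G" and w: "w \<in> verts G" and y: "y \<in> verts G" "gdist G w y = diameter G"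
  defines "d \<equiv> diameter G" and "c \<equiv> (m - 1) div 2"
  shows "d + c + 1 \<le> card (verts G)"
    and "d * (d + 1) + 2 * c * \<delta> w + c * (c + 1) + 2 * card (verts G) \<le> 2 * dist_sum G w + 2 * (d + 1 + c)"
proof -
  note basic = grown_basic[OF g]
  have fin: "finite (verts G)" using basic by (simp add: simple_graph_def)
  define L where "L i = card {z \<in> verts G. gdist G w z = i}" for i
  define A where "A = {\<delta> w<..\<delta> w + c}"
  define b where "b i = 1 + (if i \<in> A then 1 else (0::nat))" for i
  have c1: "1 \<le> c" using len by (simp add: c_def)
  have range: "gdist G w ` verts G \<subseteq> {..d}"
    using gdist_le_diameter[OF fin w] by (auto simp: d_def)
  have n: "(\<Sum>i\<le>d. L i) = card (verts G)"
    using sum.group[OF fin _ range, of "\<lambda>_. 1::nat"] by (simp add: L_def)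
  have D: "(\<Sum>i\<le>d. i * L i) = dist_sum G w"
  proof -
    have "(\<Sum>i\<le>d. i * L i) = (\<Sum>i\<le>d. \<Sum>z | z \<in> verts G \<and> gdist G w z = i. gdist G w z)"
      by (intro sum.cong) (auto simp: L_def)
    also have "\<dots> = dist_sum G w"
      unfolding dist_sum_def using sum.group[OF fin _ range, of "gdist G w"] by simp
    finally show ?thesis .
  qed
  have L2: "2 \<le> L i" if "i \<in> A" for i
  proof -
    have "i = \<delta> w + (i - \<delta> w)" "1 \<le> i - \<delta> w" "i - \<delta> w \<le> c"
      using that by (auto simp: A_def)
    then show ?thesis unfolding L_def using card_level_grown[OF g w, of "i - \<delta> w"] by (simp add: c_def)
  qed
  \<comment> \<open>The levels in \<open>A\<close> are inhabited, so none of them lies beyond the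
    diameter.\<close>
  have A: "A \<subseteq> {..d}"
  proof
    fix i assume "i \<in> A"
    then have "L i \<noteq> 0" using L2[of i] by simp
    then have "{z \<in> verts G. gdist G w z = i} \<noteq> {}" unfolding L_def by (metis card.empty)
    then show "i \<in> {..d}" using range by auto
  qed
  have L1: "1 \<le> L i" if "i \<le> d" for i
  proof -
    have "\<exists>z\<in>verts G. gdist G w z = i"
      using level_nonempty[OF basic(2) w y(1)] that y(2) by (simp add: d_def)
    then show ?thesis unfolding L_def using fin by (auto simp: Suc_le_eq card_gt_0_iff)
  qed
  have bL: "b i \<le> L i" if "i \<le> d" for i
    using L1[OF that] L2[of i] by (cases "i \<in> A") (auto simp: b_def)
  have L0: "L 0 = 1"
  proof -
    have "{z \<in> verts G. gdist G w z = 0} = {w}" using gdist_eq_0D[OF basic(2) w] w by auto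
    then show ?thesis by (simp add: L_def)
  qed
  have b0: "b 0 = 1" by (simp add: b_def A_def)
  have Ad: "{..d} \<inter> A = A" using A by auto
  have sb: "(\<Sum>i\<le>d. b i) = d + 1 + c"
  proof -
    have "(\<Sum>i\<le>d. if i \<in> A then 1 else (0::nat)) = (\<Sum>i\<in>{..d} \<inter> A. 1)"
      by (rule sum.inter_restrict[symmetric]) simp
    moreover have "(\<Sum>i\<le>d. b i) = (\<Sum>i\<le>d. 1) + (\<Sum>i\<le>d. if i \<in> A then 1 else 0)"
      unfolding b_def by (rule sum.distrib)
    moreover have "card A = c" by (simp add: A_def)
    ultimately show ?thesis unfolding Ad by simp
  qed
  have sib: "2 * (\<Sum>i\<le>d. i * b i) = d * (d + 1) + 2 * c * \<delta> w + c * (c + 1)"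
  proof -
    have "(\<Sum>i\<le>d. if i \<in> A then i else (0::nat)) = (\<Sum>i\<in>{..d} \<inter> A. i)"
      by (rule sum.inter_restrict[symmetric]) simp
    moreover have "(\<Sum>i\<le>d. i * b i) = (\<Sum>i\<le>d. i + (if i \<in> A then i else 0))"
      by (intro sum.cong) (auto simp: b_def)
    moreover have "2 * (\<Sum>i\<le>d. i) = d * (d + 1)" by (induction d) auto
    ultimately show ?thesis using sum_shifted_interval[of "\<delta> w" c] unfolding Ad
      by (simp add: sum.distrib A_def)
  qed
  show "d + c + 1 \<le> card (verts G)"
    using sum_mono[of "{..d}" b L] bL n sb by simp
  \<comment> \<open>For positive \<open>i\<close> this says that each of the
    \<open>L i - b i\<close> surplus vertices costs at least 1; level 0 consists of \<open>w\<close>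
    alone and has no surplus.\<close>
  have "i * b i + L i \<le> i * L i + b i" if "i \<le> d" for i
  proof (cases i)
    case 0
    then show ?thesis using L0 b0 by simp
  next
    case (Suc j)
    then show ?thesis using bL[OF that] mult_le_mono2[OF bL[OF that], of j] by simp
  qed
  then have "(\<Sum>i\<le>d. i * b i + L i) \<le> (\<Sum>i\<le>d. i * L i + b i)" by (intro sum_mono) simp
  then show "d * (d + 1) + 2 * c * \<delta> w + c * (c + 1) + 2 * card (verts G) \<le> 2 * dist_sum G w + 2 * (d + 1 + c)"
    using sib by (simp add: sum.distrib n D sb)
qed

end

section \<open>Cycles with two balanced arms\<close>

text \<open>Arms grow alternately at \<open>v\<^sub>0\<close> and at its opposite vertex. Of the two ends of the arms,
  \<open>p\<close> is the one to be extended next.\<close>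

inductive two_arms :: "'a list \<Rightarrow> ('a \<Rightarrow> nat) \<Rightarrow> nat \<Rightarrow> 'a \<Rightarrow> 'a \<Rightarrow> 'a ugraph \<Rightarrow> bool" for ys \<delta> where
  start: "\<forall>x\<in>set ys. \<delta> x = 0 \<Longrightarrow>
    two_arms ys \<delta> 0 (ys ! 0) (ys ! (length ys div 2)) (cycle_graph ys)"
| step: "two_arms ys \<delta> k p q G \<Longrightarrow> v \<notin> verts G \<Longrightarrow> \<delta> v = Suc (\<delta> p) \<Longrightarrow>
    two_arms ys \<delta> (Suc k) q v (add_leaf G v p)"

inductive_cases two_arms_0E: "two_arms ys \<delta> 0 p q G"
inductive_cases two_arms_SucE: "two_arms ys \<delta> (Suc k) p q G"

text \<open>The distances from a cycle vertex, separated by direction: one way round they run up to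
  \<open>m div 2\<close>, the other way up to \<open>(m - 1) div 2\<close>. In this form they match
  the bound of \<open>dist_sum_grown_ge\<close>.\<close>

lemma twice_square_div_4: "2 * (m * m div 4) = m div 2 * (m div 2 + 1) + (m - 1) div 2 * ((m - 1) div 2 + 1)"
  for m :: nat
proof (cases "even m")
  case True
  then obtain j where "m = 2 * j" by blast
  moreover have "(2 * j - 1) div 2 = j - 1" by simp
  ultimately show ?thesis by (cases j) (auto simp: algebra_simps)
next
  case False
  then obtain j where "m = 2 * j + 1" by (elim oddE)
  moreover have "(2 * j + 1) * (2 * j + 1) div 4 = j * j + j"
  proof -
    have "(2 * j + 1) * (2 * j + 1) = 1 + (j * j + j) * 4" by algebra
    then show ?thesis by (simp only: div_mult_self1)
  qed
  ultimately show ?thesis by (simp add: algebra_simps)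
qed

context cycle_list
begin

text \<open>The last conjunct serves the case of equality: off the cycle, only ends of the arms
  reach depth k/2. The condition \<open>0 < \<delta> x\<close> keeps the cycle vertices out when
  \<open>k = 0\<close>.\<close>

lemma two_arms_grown:
  assumes "two_arms xs \<delta> k p q G"
  shows "grown xs \<delta> G \<and> p \<in> verts G \<and> q \<in> verts G \<and> \<delta> p = k div 2 \<and> \<delta> q = Suc k div 2
    \<and> (\<forall>x\<in>verts G. 2 * \<delta> x \<le> Suc k) \<and> card (verts G) = m + k
    \<and> (\<forall>x\<in>verts G. k \<le> 2 * \<delta> x \<longrightarrow> 0 < \<delta> x \<longrightarrow> x = q \<or> x = p \<and> even k)"
  using assms
proof induction
  case start
  have "0 < m" "m div 2 < m" using len by auto
  then show ?case using start dist by (auto simp: distinct_card intro: grown.cycle)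
next
  case (step k p q G v)
  then have IH: "grown xs \<delta> G" "p \<in> verts G" "q \<in> verts G" "\<delta> p = k div 2" "\<delta> q = Suc k div 2"
    "card (verts G) = m + k" "\<And>x. x \<in> verts G \<Longrightarrow> 2 * \<delta> x \<le> Suc k"
    "\<And>x. x \<in> verts G \<Longrightarrow> k \<le> 2 * \<delta> x \<Longrightarrow> 0 < \<delta> x \<Longrightarrow> x = q \<or> x = p \<and> even k"
    by auto
  interpret leaf_attachment G v p using IH step by (intro leaf_attachment_grown)
  have far: "2 * \<delta> x \<le> Suc (Suc k)" if "x \<in> verts G" for x
    using IH(7)[OF that] by simp
  have dv: "\<delta> v = Suc (Suc k) div 2" using IH step by simp
  have "\<delta> x \<le> \<delta> v" if "x \<in> verts G" for x
    using far[OF that] unfolding dv by simp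
  then have "grown xs \<delta> H" using IH step by (intro grown.leaf) auto
  moreover have "x = v \<or> x = q \<and> even (Suc k)" if "x \<in> verts H" "Suc k \<le> 2 * \<delta> x" "0 < \<delta> x" for x
  proof (cases "x = v")
    case False
    then have x: "x = q \<or> x = p \<and> even k" using IH(8)[of x] that by auto
    moreover have "\<not> (x = p \<and> even k)" using IH(4) that by auto
    ultimately have "x = q" by blast
    then have "even (Suc k)" using IH(5) that by (auto elim!: evenE)
    then show ?thesis using \<open>x = q\<close> by simp
  qed simp
  moreover have "2 * \<delta> x \<le> Suc (Suc k)" if "x \<in> verts H" for x
    using far that dv by auto
  moreover have "card (verts H) = m + Suc k" using IH unfolding card_H by simp
  ultimately show ?case using IH(1-6) dv by simp
qed

text \<open>For \<open>d = k + m div 2\<close> there are exactly \<open>d + 1 + c\<close> vertices,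
  so there is no surplus and the bound of \<open>dist_sum_grown_ge\<close> is attained. Both ends
  are carried along because they exchange roles at every step.\<close>

lemma two_arms_dist_sum:
  assumes "two_arms xs \<delta> k p q G"
  defines "c \<equiv> (m - 1) div 2"
  shows "gdist G p q = k + m div 2 \<and>
     2 * dist_sum G p = (k + m div 2) * (k + m div 2 + 1) + 2 * c * \<delta> p + c * (c + 1) \<and>
     2 * dist_sum G q = (k + m div 2) * (k + m div 2 + 1) + 2 * c * \<delta> q + c * (c + 1)"
  using assms(1)
proof induction
  case start
  have l: "0 < m" "m div 2 < m" using len by auto
  have "gdist (cycle_graph xs) (xs ! 0) (xs ! (m div 2)) = m div 2"
    using gdist_nth(1)[of "m div 2"] l by simp
  moreover have "2 * dist_sum (cycle_graph xs) (xs ! j) = m div 2 * (m div 2 + 1) + c * (c + 1)"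
    if "j < m" for j
    using dist_sum_cycle[of "xs ! j"] twice_square_div_4[of m] that by (simp add: c_def)
  ultimately show ?case using l start by simp
next
  case (step k p q G v)
  note facts = two_arms_grown[OF step.hyps(1)]
  interpret leaf_attachment G v p using facts step by (intro leaf_attachment_grown) auto
  have "m + k = k + m div 2 + 1 + c" using len by (simp add: c_def)
  then have n: "card (verts G) = k + m div 2 + 1 + c" using facts by simp
  define d where "d = k + m div 2"
  have q: "dist_sum H q = dist_sum G q + d + 1"
    using facts step gdist_sym[of G p q] by (simp add: dist_sum_old d_def)
  have v: "dist_sum H v = dist_sum G p + d + 1 + c"
    using n by (simp add: dist_sum_new d_def)
  have "gdist H q v = Suc d"
    using facts step gdist_sym[of G p q] by (simp add: gdist_old_new d_def)
  then show ?case using q v step.IH step.hyps unfolding d_def[symmetric]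
    by (simp add: d_def[symmetric] algebra_simps)
qed

lemma diameter_grown_le:
  assumes "grown xs \<delta> G"
  shows "diameter G + (m - 1) div 2 + 1 \<le> card (verts G)"
proof -
  note basic = grown_basic[OF assms]
  have "finite (verts G)" "verts G \<noteq> {}" using basic(1,3) by (auto simp: simple_graph_def)
  then obtain u v where "u \<in> verts G" "v \<in> verts G" "gdist G u v = diameter G"
    by (rule diameter_attained)
  then show ?thesis using dist_sum_grown_ge(1)[OF assms] by blast
qed

lemma diameter_two_arms:
  assumes "two_arms xs \<delta> k p q G"
  shows "diameter G = k + m div 2"
proof (rule antisym)
  note facts = two_arms_grown[OF assms]
  have "m + k = k + m div 2 + 1 + (m - 1) div 2" using len by presburger
  then show "diameter G \<le> k + m div 2" using diameter_grown_le[of \<delta> G] facts by simp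
  have "finite (verts G)" using grown_basic(1)[of \<delta> G] facts by (simp add: simple_graph_def)
  then show "k + m div 2 \<le> diameter G"
    using gdist_le_diameter[of G p q] two_arms_dist_sum[OF assms] facts by simp
qed

lemma degree_distance_cycle: "degree_distance (cycle_graph xs) = m * (2 * (m * m div 4))"
  using dist by (simp add: degree_distance_def degree_cycle_graph dist_sum_cycle distinct_card)

section \<open>Different presentations of the same two-arm graph\<close>

lemma cycle_list_reflect: "j < m \<Longrightarrow> cycle_list (reflect j xs)"
  using dist len by unfold_locales (auto simp: distinct_reflect)

text \<open>When both arms have the same length, reflecting the cycle so that the attachment
  vertices trade places exchanges the arms. The induction strips one leaf from each arm and attaches
  the two in the other order.\<close>

lemma two_arms_swap:
  assumes "two_arms xs \<delta> (2 * j) p q G"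
  shows "two_arms (reflect (m div 2) xs) \<delta> (2 * j) q p G"
  using assms
proof (induction j arbitrary: p q G)
  case 0
  have l: "m div 2 < m" using len by auto
  then have r: "reflect (m div 2) xs ! 0 = xs ! (m div 2)" "reflect (m div 2) xs ! (m div 2) = xs ! 0"
    by (simp_all add: nth_reflect)
  show ?case using 0 two_arms.start[of "reflect (m div 2) xs" \<delta>] l r
    by (auto simp: cycle_graph_reflect elim!: two_arms_0E)
next
  case (Suc j)
  then have "two_arms xs \<delta> (Suc (Suc (2 * j))) p q G" by simp
  then obtain G1 p1 where 1: "two_arms xs \<delta> (Suc (2 * j)) p1 p G1" "q \<notin> verts G1"
    "\<delta> q = Suc (\<delta> p1)" "G = add_leaf G1 q p1"
    by (auto elim: two_arms_SucE)
  from 1(1) obtain G0 p0 where 0: "two_arms xs \<delta> (2 * j) p0 p1 G0" "p \<notin> verts G0"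
    "\<delta> p = Suc (\<delta> p0)" "G1 = add_leaf G0 p p0"
    by (auto elim: two_arms_SucE)
  have "two_arms (reflect (m div 2) xs) \<delta> (Suc (2 * j)) p0 q (add_leaf G0 q p1)"
    by (rule two_arms.step[OF Suc.IH[OF 0(1)]]) (use 1 0 in auto)
  then have "two_arms (reflect (m div 2) xs) \<delta> (Suc (Suc (2 * j))) q p (add_leaf (add_leaf G0 q p1) p p0)"
    by (rule two_arms.step) (use 1 0 in auto)
  then show ?case using 1 0 by (simp add: add_leaf_commute)
qed

text \<open>Equality of gains reveals only the depth and the eccentricity of \<open>w\<close>; up to
  the choice of the list this makes \<open>w\<close> the end to be extended. The far vertex
  \<open>y\<close> excludes cycle vertices too close to a single leaf (\<open>k = 1\<close>) and,
  for larger odd \<open>k\<close>, the parent of \<open>q\<close>.\<close>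

lemma two_arms_choose_end:
  assumes ta: "two_arms xs \<delta> k p q G" and wG: "w \<in> verts G" "\<delta> w = k div 2"
    and y: "y \<in> verts G" "gdist G w y = k + m div 2"
  obtains ys q' where "cycle_list ys" "length ys = m" "two_arms ys \<delta> k w q' G"
proof -
  note facts = two_arms_grown[OF ta]
  have far: "x = q \<or> x = p \<and> even k" if "x \<in> verts G" "k \<le> 2 * \<delta> x" "0 < \<delta> x" for x
    using facts that by blast
  \<comment> \<open>What the cycle does not supply of the distance must come from depth, so
    \<open>y\<close> has at least depth k/2.\<close>
  have "k + m div 2 \<le> \<delta> w + \<delta> y + m div 2"
    using gdist_grown_le[of \<delta> G w y] facts wG y by simp
  then have dy: "k \<le> 2 * \<delta> y" "k \<le> k div 2 + \<delta> y" using wG by auto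
  consider "k = 0" | "k = 1" | "k \<ge> 2" "even k" | "k \<ge> 2" "odd k" by linarith
  then show thesis
  proof cases
    case 1
    then have G: "G = cycle_graph xs" and z: "\<forall>x\<in>set xs. \<delta> x = 0"
      using ta by (auto elim: two_arms_0E elim!: two_arms.cases)
    then have "w \<in> set xs" using wG by simp
    then obtain ys where "cycle_list ys" "cycle_graph ys = cycle_graph xs" "set ys = set xs"
      "length ys = m" "ys ! 0 = w" by (rule reroot)
    then show thesis using that two_arms.start[of ys \<delta>] z G 1 by metis
  next
    case 2
    then have "two_arms xs \<delta> (Suc 0) p q G" using ta by simp
    then obtain p0 where p0: "q \<notin> set xs"
      "\<delta> q = Suc (\<delta> p0)" "G = add_leaf (cycle_graph xs) q p0" "p0 = xs ! 0" "p = xs ! (m div 2)"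
      "\<forall>x\<in>set xs. \<delta> x = 0"
      by (auto elim!: two_arms_SucE two_arms_0E)
    interpret leaf_attachment "cycle_graph xs" q p0
      using p0 simple_cycle_graph connected_cycle_graph by unfold_locales auto
    have "y = q" using far[of y] y dy 2 by auto
    have wx: "w \<in> set xs" using wG p0 2 by auto
    then obtain j where j: "j < m" "w = xs ! j" by (metis in_set_conv_nth)
    have "gdist G w y = Suc (gdist (cycle_graph xs) w (xs ! 0))"
      using gdist_old_new[of w] wx p0 \<open>y = q\<close> by simp
    then have "min j (m - j) = m div 2"
      using y 2 gdist_nth(1)[OF j(1)] j gdist_sym[of "cycle_graph xs" w "xs ! 0"] by simp
    \<comment> \<open>For odd \<open>m\<close> the vertex \<open>xs ! 0\<close> has two opposite
      vertices; the second becomes the first when the cycle is reversed around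
      \<open>xs ! 0\<close>.\<close>
    then consider "j = m div 2" | "j = m - m div 2"
      using j by (auto simp: min_def split: if_splits)
    then show thesis
    proof cases
      case 1
      then show thesis using that[of xs q] ta p0 j cycle_list_axioms by simp
    next
      case jj: 2
      let ?ys = "reflect 0 xs"
      have l: "0 < m" "m div 2 < m" "0 < m div 2" using len by auto
      have "\<not> m div 2 \<le> 0" using len by linarith
      then have "?ys ! (m div 2) = xs ! (m - m div 2)"
        by (simp only: nth_reflect[OF l(2)] if_False add_0)
      moreover have "?ys ! 0 = xs ! 0" by (simp add: nth_reflect)
      ultimately have r: "?ys ! 0 = p0" "?ys ! (m div 2) = w" using jj j p0 by simp_all
      have "two_arms ?ys \<delta> 0 (?ys ! 0) (?ys ! (m div 2)) (cycle_graph ?ys)"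
        using two_arms.start[of ?ys \<delta>] p0 l by simp
      then have "two_arms ?ys \<delta> 0 p0 w (cycle_graph xs)"
        using r l by (simp only: cycle_graph_reflect)
      then have "two_arms ?ys \<delta> (Suc 0) w q G"
        unfolding p0(3) using p0 by (intro two_arms.step) auto
      then show thesis using that[of ?ys q] cycle_list_reflect[of 0] 2 l by simp
    qed
  next
    case 3
    then have "0 < \<delta> w" "k \<le> 2 * \<delta> w" using wG by (auto elim: evenE)
    then consider "w = p" | "w = q" using far wG by blast
    then show thesis
    proof cases
      case 1
      then show thesis using that[of xs q] ta cycle_list_axioms by simp
    next
      case 2
      obtain j where "k = 2 * j" using 3 by blast
      then have "two_arms (reflect (m div 2) xs) \<delta> k q p G" using two_arms_swap ta by simp
      moreover have "m div 2 < m" using len by simp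
      ultimately show thesis using that[of "reflect (m div 2) xs" p] cycle_list_reflect 2 by simp
    qed
  next
    case 4
    then have "y = q" using far[of y] y dy by auto
    obtain k' where k': "k = Suc k'" using 4 by (cases k) auto
    with ta have "two_arms xs \<delta> (Suc k') p q G" by simp
    then obtain G0 p0 where G0: "two_arms xs \<delta> k' p0 p G0" "q \<notin> verts G0" "G = add_leaf G0 q p0"
      by (auto elim: two_arms_SucE)
    note facts0 = two_arms_grown[OF G0(1)]
    interpret leaf_attachment G0 q p0 using facts0 G0 by (intro leaf_attachment_grown) auto
    have "even k'" using 4 k' by simp
    then obtain j where j: "k' = 2 * j" by blast
    then have "\<delta> w = j" "\<delta> q = Suc j" using facts wG(2) k' by simp_all
    then have "w \<noteq> q" "k' \<le> 2 * \<delta> w" "0 < \<delta> w" using j k' 4 by auto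
    then have "w \<in> verts G0" using wG(1) G0(3) by simp
    then have "w = p \<or> w = p0"
      using facts0 \<open>k' \<le> 2 * \<delta> w\<close> \<open>0 < \<delta> w\<close> by blast
    \<comment> \<open>\<open>p0\<close> is adjacent to \<open>y = q\<close>, whereas
      \<open>w\<close> is at distance \<open>k + m div 2\<close> from \<open>y\<close>.\<close>
    moreover have "w \<noteq> p0"
    proof
      assume "w = p0"
      then have "gdist G w y = 1" using \<open>y = q\<close> gdist_old_new[of p0] facts0 G0 by simp
      then show False using y 4 by simp
    qed
    ultimately show thesis using that[of xs q] ta cycle_list_axioms by simp
  qed
qed

end

section \<open>The extremal inequality\<close>

lemma reverse_degree_distance_grown:
  assumes "cycle_list xs" "grown xs \<delta> G"
  shows "reverse_degree_distance G
    = 2 * (int (card (verts G)) - 1) * int (card (verts G)) * int (diameter G) - int (degree_distance G)"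
  using cycle_list.card_edges_grown[OF assms] by (simp add: reverse_degree_distance_def)

lemma reverse_degree_distance_leaf:
  assumes "cycle_list xs" "grown xs \<delta> G" "w \<in> verts G" "v \<notin> verts G" "grown xs \<delta> (add_leaf G v w)"
    and "n = card (verts G)"
  shows "reverse_degree_distance (add_leaf G v w) = reverse_degree_distance G
    + 2 * int n * (int n + 1) * int (diameter (add_leaf G v w)) - 2 * (int n - 1) * int n * int (diameter G)
    - (4 * int (dist_sum G w) + 2 * int n + int (length xs) + 2 * int (\<delta> w) + 1)"
proof -
  interpret cycle_list xs by fact
  interpret leaf_attachment G v w using assms by (intro leaf_attachment_grown)
  have "int (card (verts H)) = int n + 1" using assms(6) by (simp only: card_H of_nat_Suc)
  then show ?thesis
    using reverse_degree_distance_grown[OF assms(1,2)] reverse_degree_distance_grown[OF assms(1,5)]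
      degree_distance_leaf[OF assms(2-4)] assms(6)
    by (simp add: algebra_simps)
qed

text \<open>Here \<open>d\<close>, \<open>D\<close>, \<open>r\<close> stand for the diameter of the graph, the distance sum of the vertex
  to which the leaf is attached, and the distance of that vertex to the cycle; \<open>e\<close>, \<open>E\<close>, \<open>s\<close>
  are the same quantities for the balanced graph. Both sides are half the gain, up to a common constant.\<close>

lemma gain_diameter_fixed:
  fixes n c d e D E r s :: int
  assumes "n = e + 1 + c" "d \<le> e" "2 * E = e * (e + 1) + 2 * c * s + c * (c + 1)"
    and "0 \<le> c" "0 \<le> s" "s \<le> e" "0 \<le> D" "0 \<le> r" "0 \<le> d"
  shows "2 * n * d - 2 * D - r < n * (n + 1 + 2 * e) - 2 * E - s"
proof -
  \<comment> \<open>\<open>x\<close> is c (e - s) and \<open>y\<close> is n (e - d). With them the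
    difference of the gains is linear, and it is positive because s \<le> e.\<close>
  define x where "x = c * e - c * s"
  define y where "y = n * e - n * d"
  have "c * s \<le> c * e" "n * d \<le> n * e" using assms by (auto intro: mult_left_mono)
  then have "0 \<le> x" "0 \<le> y" by (simp_all add: x_def y_def)
  moreover have "n * (n + 1 + 2 * e) - 2 * E - s - (2 * n * d - 2 * D - r)
      = 2 * e + 2 + 2 * c - s + 2 * x + 2 * y + 2 * D + r"
    unfolding x_def y_def assms(1,3) by algebra
  ultimately have "0 < n * (n + 1 + 2 * e) - 2 * E - s - (2 * n * d - 2 * D - r)"
    using assms(4-9) by linarith
  then show ?thesis by (simp only: diff_gt_0_iff_gt)
qed

text \<open>With the diameter deficit t = e - d and the excess x of \<open>r\<close> over its least
  admissible value s - t, the gains differ by at least t^2 + 2t + 2cx + x. This vanishes only for t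
  = x = 0, so one estimate yields both the inequality and the case of equality.\<close>

lemma gain_diameter_increased:
  fixes n c d e D E r s :: int
  assumes "n = e + 1 + c" "d \<le> e" "2 * E = e * (e + 1) + 2 * c * s + c * (c + 1)"
    and "0 \<le> c" "d * (d + 1) + 2 * c * r + c * (c + 1) + 2 * n \<le> 2 * D + 2 * (d + 1 + c)"
    and "s \<le> r + (e - d)"
  shows "n * (n + 1 + 2 * d) - 2 * D - r \<le> n * (n + 1 + 2 * e) - 2 * E - s"
    and "n * (n + 1 + 2 * d) - 2 * D - r = n * (n + 1 + 2 * e) - 2 * E - s \<Longrightarrow> d = e \<and> r = s"
proof -
  define t where "t = e - d"
  have t: "0 \<le> t" "d = e - t" using assms by (auto simp: t_def)
  define x where "x = r - s + t"
  have x: "0 \<le> x" "r = s - t + x" using assms by (auto simp: x_def t_def)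
  have "d * (d + 1) + 2 * c * r + c * (c + 1) + 2 * n - 2 * (d + 1 + c)
      = 2 * E - 2 * t * n + 2 * c * t + t * t + 3 * t + 2 * c * (r - s)"
    unfolding assms(1,3) t(2) by algebra
  then have "2 * n * t + 2 * D + r - 2 * E - s \<ge> 2 * c * t + t * t + 3 * t + (2 * c + 1) * (r - s)"
    using assms(5) by (simp add: algebra_simps)
  moreover have "2 * c * t + t * t + 3 * t + (2 * c + 1) * (r - s) = t * t + 2 * t + 2 * (c * x) + x"
    unfolding x(2) by algebra
  moreover have "n * (n + 1 + 2 * e) - 2 * E - s - (n * (n + 1 + 2 * d) - 2 * D - r)
      = 2 * n * t + 2 * D + r - 2 * E - s"
    unfolding t_def by algebra
  ultimately have gap: "t * t + 2 * t + 2 * (c * x) + x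
      \<le> n * (n + 1 + 2 * e) - 2 * E - s - (n * (n + 1 + 2 * d) - 2 * D - r)"
    by linarith
  have pos: "0 \<le> t * t" "0 \<le> c * x" using assms x by auto
  then show "n * (n + 1 + 2 * d) - 2 * D - r \<le> n * (n + 1 + 2 * e) - 2 * E - s"
    using gap t x by linarith
  assume "n * (n + 1 + 2 * d) - 2 * D - r = n * (n + 1 + 2 * e) - 2 * E - s"
  then have "t = 0" "x = 0" using gap pos t x by linarith+
  then show "d = e \<and> r = s" by (simp add: x_def t_def)
qed

text \<open>\<open>U\<close> is an arbitrary two-arm graph over an arbitrary cycle of the same
  length, so that the induction hypothesis applies to \<open>U\<close> without its last
  leaf.\<close>

lemma grown_le_two_arms:
  assumes xs: "cycle_list xs" and G: "grown xs \<delta> G"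
    and zs: "cycle_list zs" "length zs = length xs" and U: "two_arms zs \<epsilon> k p q U"
    and card: "card (verts G) = length xs + k"
  shows "reverse_degree_distance G \<le> reverse_degree_distance U \<and>
    (reverse_degree_distance G = reverse_degree_distance U \<longrightarrow>
      (\<exists>ys p' q'. cycle_list ys \<and> length ys = length xs \<and> two_arms ys \<delta> k p' q' G))"
  using G U card
proof (induction arbitrary: k p q U)
  case cycle
  interpret cycle_list xs by fact
  have k: "k = 0" using cycle dist by (simp add: distinct_card)
  then have U: "U = cycle_graph zs" using cycle by (auto elim: two_arms_0E)
  have start: "two_arms xs \<delta> 0 (xs ! 0) (xs ! (m div 2)) (cycle_graph xs)"
    using cycle by (intro two_arms.start)
  have "diameter U = diameter (cycle_graph xs)"
    using diameter_two_arms[OF start] cycle_list.diameter_two_arms[OF zs(1) cycle(2)] k zs(2) by simp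
  moreover have "degree_distance U = degree_distance (cycle_graph xs)"
    using degree_distance_cycle cycle_list.degree_distance_cycle[OF zs(1)] zs(2) U by simp
  moreover have "card (verts U) = card (verts (cycle_graph xs))"
    using U dist zs cycle_list.dist[OF zs(1)] by (simp add: distinct_card)
  moreover have "card (edges U) = card (edges (cycle_graph xs))"
    using U card_cycle_edges zs cycle_list.card_cycle_edges[OF zs(1)] by simp
  ultimately have "reverse_degree_distance (cycle_graph xs) = reverse_degree_distance U"
    by (simp add: reverse_degree_distance_def)
  then show ?case using start k cycle_list_axioms by auto
next
  case (leaf G w v)
  interpret cycle_list xs by fact
  interpret leaf_attachment G v w using leaf by (intro leaf_attachment_grown)
  \<comment> \<open>The \<open>m\<close> cycle vertices precede the leaf, so \<open>k\<close> is
    positive and \<open>U\<close> has a last leaf to strip as well.\<close>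
  have "m \<le> card (verts G)"
    using card_mono[of "verts G" "set xs"] grown_basic(3)[OF leaf.hyps(1)] dist by (simp add: distinct_card)
  then obtain j where k: "k = Suc j" and cj: "card (verts G) = m + j"
    using leaf.prems(2) by (cases k) (auto simp: card_H simp del: verts_add_leaf)
  from leaf.prems(1) k obtain K p0 where K: "two_arms zs \<epsilon> j p0 p K" "q \<notin> verts K"
    "\<epsilon> q = Suc (\<epsilon> p0)" "U = add_leaf K q p0"
    by (auto elim: two_arms_SucE)
  note IH = leaf.IH[OF K(1) cj]
  have gG: "grown xs \<delta> (add_leaf G v w)" using leaf.hyps by (intro grown.leaf)
  interpret Z: cycle_list zs by fact
  note factsK = Z.two_arms_grown[OF K(1)] and factsU = Z.two_arms_grown[OF leaf.prems(1)]
  define c where "c = (m - 1) div 2"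
  define n where "n = m + j"
  have half: "m + j = j + m div 2 + 1 + c" using len by (simp add: c_def)
  have dK: "diameter K = j + m div 2" and dU: "diameter U = j + m div 2 + 1"
    using Z.diameter_two_arms[OF K(1)] Z.diameter_two_arms[OF leaf.prems(1)] k zs(2) by simp_all
  have gK: "grown zs \<epsilon> K" "p0 \<in> verts K" "grown zs \<epsilon> (add_leaf K q p0)" "n = card (verts K)"
    using factsK factsU K(4) zs(2) by (simp_all only: n_def)
  have rU: "reverse_degree_distance U = reverse_degree_distance K
    + 2 * int n * (int n + 1) * int (j + m div 2 + 1) - 2 * (int n - 1) * int n * int (j + m div 2)
    - (4 * int (dist_sum K p0) + 2 * int n + int m + 2 * int (\<epsilon> p0) + 1)"
    using reverse_degree_distance_leaf[OF zs(1) gK(1,2) K(2) gK(3,4)]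
    unfolding K(4)[symmetric] dK dU zs(2) .
  have rG: "reverse_degree_distance (add_leaf G v w) = reverse_degree_distance G
    + 2 * int n * (int n + 1) * int (diameter (add_leaf G v w)) - 2 * (int n - 1) * int n * int (diameter G)
    - (4 * int (dist_sum G w) + 2 * int n + int m + 2 * int (\<delta> w) + 1)"
    by (rule reverse_degree_distance_leaf[OF xs leaf.hyps(1-3) gG]) (simp add: n_def cj)
  define d e where "d = diameter G" and "e = j + m div 2"
  have de: "d \<le> e" using diameter_grown_le[OF leaf.hyps(1)] cj half by (simp add: d_def e_def c_def)
  have ne: "int n = int e + 1 + int c" using half by (simp add: n_def e_def)
  have "2 * dist_sum K p0 = e * (e + 1) + 2 * c * \<epsilon> p0 + c * (c + 1)"
    using Z.two_arms_dist_sum[OF K(1)] zs(2) by (simp add: e_def c_def)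
  then have "int (2 * dist_sum K p0) = int (e * (e + 1) + 2 * c * \<epsilon> p0 + c * (c + 1))"
    by (simp only:)
  then have E: "2 * int (dist_sum K p0) = int e * (int e + 1) + 2 * int c * int (\<epsilon> p0) + int c * (int c + 1)"
    by (simp only: of_nat_add of_nat_mult of_nat_1 of_nat_numeral)
  have s: "\<epsilon> p0 = j div 2" using factsK by simp
  then have se: "\<epsilon> p0 \<le> e" by (simp add: e_def)
  \<comment> \<open>The factor \<open>n * (n + 1 + 2 * e)\<close> is half of 2n(n + 1)(e + 1) - 2(n
    - 1)ne; the remaining \<open>2 n + m + 1\<close> is common to both graphs.\<close>
  have gainU: "2 * (int n * (int n + 1 + 2 * int e) - 2 * int (dist_sum K p0) - int (\<epsilon> p0))
      = reverse_degree_distance U - reverse_degree_distance K + 2 * int n + int m + 1"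
    unfolding rU e_def by (simp add: algebra_simps)
  consider "diameter (add_leaf G v w) = d"
    | y where "diameter (add_leaf G v w) = Suc d" "y \<in> verts G" "gdist G w y = d"
    using diameter_cases by (auto simp: d_def)
  then show ?case
  proof cases
    case 1
    have "2 * (2 * int n * int d - 2 * int (dist_sum G w) - int (\<delta> w))
        = reverse_degree_distance (add_leaf G v w) - reverse_degree_distance G + 2 * int n + int m + 1"
      unfolding rG 1 d_def[symmetric] by (simp add: algebra_simps)
    note gain = this
    have strict: "2 * int n * int d - 2 * int (dist_sum G w) - int (\<delta> w)
        < int n * (int n + 1 + 2 * int e) - 2 * int (dist_sum K p0) - int (\<epsilon> p0)"
      by (rule gain_diameter_fixed[OF ne _ E]) (use de se in auto)
    have "reverse_degree_distance (add_leaf G v w) < reverse_degree_distance U"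
      using mult_strict_left_mono[OF strict, of 2, unfolded gain gainU] IH by simp
    then show ?thesis by simp
  next
    case 2
    have gain: "2 * (int n * (int n + 1 + 2 * int d) - 2 * int (dist_sum G w) - int (\<delta> w))
        = reverse_degree_distance (add_leaf G v w) - reverse_degree_distance G + 2 * int n + int m + 1"
      unfolding rG 2 d_def[symmetric] by (simp add: algebra_simps)
    have "d * (d + 1) + 2 * c * \<delta> w + c * (c + 1) + 2 * n \<le> 2 * dist_sum G w + 2 * (d + 1 + c)"
      using dist_sum_grown_ge(2)[OF leaf.hyps(1) w 2(2)] 2(3) cj by (simp add: d_def c_def n_def)
    then have "int (d * (d + 1) + 2 * c * \<delta> w + c * (c + 1) + 2 * n)
        \<le> int (2 * dist_sum G w + 2 * (d + 1 + c))"
      by (simp only: of_nat_le_iff)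
    then have D: "int d * (int d + 1) + 2 * int c * int (\<delta> w) + int c * (int c + 1) + 2 * int n
        \<le> 2 * int (dist_sum G w) + 2 * (int d + 1 + int c)"
      by (simp only: of_nat_add of_nat_mult of_nat_1 of_nat_numeral)
    have "d \<le> \<delta> w + \<delta> y + m div 2"
      using gdist_grown_le[OF leaf.hyps(1) w 2(2)] 2(3) by simp
    \<comment> \<open>Leaves arrive in the order of depth, so no vertex of \<open>G\<close> is
      deeper than the new leaf.\<close>
    moreover have "\<delta> y \<le> Suc (\<delta> w)" using leaf.hyps 2 by auto
    ultimately have "j \<le> 2 * \<delta> w + 1 + (e - d)" using de by (simp add: e_def)
    \<comment> \<open>The extra 1 disappears by rounding down if \<open>e = d\<close>; otherwise
      halving \<open>e - d\<close> leaves room for it.\<close>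
    then have "\<epsilon> p0 \<le> \<delta> w + (e - d)" unfolding s by presburger
    then have sr: "int (\<epsilon> p0) \<le> int (\<delta> w) + (int e - int d)" using de by linarith
    note gap = gain_diameter_increased[OF ne _ E _ D sr]
    have "int d \<le> int e" "0 \<le> int c" using de by simp_all
    note le = mult_left_mono[OF gap(1)[OF this], of 2, unfolded gain gainU]
    then have "reverse_degree_distance (add_leaf G v w) \<le> reverse_degree_distance U"
      using IH by simp
    moreover have "\<exists>ys p' q'. cycle_list ys \<and> length ys = m \<and> two_arms ys \<delta> k p' q' (add_leaf G v w)"
      if "reverse_degree_distance (add_leaf G v w) = reverse_degree_distance U"
    proof -
      \<comment> \<open>Equality of the totals forces equality both for the smaller graphs and for
        the gains.\<close>
      have eq: "reverse_degree_distance G = reverse_degree_distance K" using le IH that by simp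
      then have "2 * (int n * (int n + 1 + 2 * int d) - 2 * int (dist_sum G w) - int (\<delta> w))
          = 2 * (int n * (int n + 1 + 2 * int e) - 2 * int (dist_sum K p0) - int (\<epsilon> p0))"
        unfolding gain gainU using that by simp
      then have gain_eq: "int n * (int n + 1 + 2 * int d) - 2 * int (dist_sum G w) - int (\<delta> w)
          = int n * (int n + 1 + 2 * int e) - 2 * int (dist_sum K p0) - int (\<epsilon> p0)"
        by (rule mult_left_cancel[THEN iffD1, rotated]) simp
      have "int d = int e \<and> int (\<delta> w) = int (\<epsilon> p0)" using gap(2)[OF _ _ gain_eq] de by simp
      then have de': "d = e" and r: "\<delta> w = j div 2" using s by simp_all
      obtain ys p1 q1 where ys: "cycle_list ys" "length ys = m" "two_arms ys \<delta> j p1 q1 G"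
        using IH eq by blast
      have "gdist G w y = j + length ys div 2" using 2(3) de' ys(2) by (simp add: e_def)
      then obtain us q2 where us: "cycle_list us" "length us = m" "two_arms us \<delta> j w q2 G"
        using cycle_list.two_arms_choose_end[OF ys(1,3) w r 2(2)] ys(2) by metis
      have "two_arms us \<delta> k q2 v (add_leaf G v w)"
        unfolding k using us(3) leaf.hyps by (intro two_arms.step) auto
      then show ?thesis using us by blast
    qed
    ultimately show ?thesis by blast
  qed
qed

section \<open>Isomorphisms\<close>

text \<open>Isomorphism as an equation between edge sets: attaching a leaf on both sides then only
  inserts one matching edge.\<close>

definition iso_map :: "('a \<Rightarrow> 'b) \<Rightarrow> 'a ugraph \<Rightarrow> 'b ugraph \<Rightarrow> bool" where
  "iso_map f G H \<longleftrightarrow> bij_betw f (verts G) (verts H) \<and> edges H = (`) f ` edges G"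

lemma isomorphic_imp_iso_map:
  assumes "simple_graph G" "simple_graph H" "isomorphic G H"
  obtains f where "iso_map f G H"
proof -
  obtain f where bij: "bij_betw f (verts G) (verts H)"
    and f: "\<And>u v. u \<in> verts G \<Longrightarrow> v \<in> verts G \<Longrightarrow> {u, v} \<in> edges G \<longleftrightarrow> {f u, f v} \<in> edges H"
    using assms(3) by (auto simp: isomorphic_def)
  have pair: "\<exists>u v. e = {u, v} \<and> u \<in> verts K \<and> v \<in> verts K" if "simple_graph K" "e \<in> edges K"
    for e and K :: "'c ugraph"
  proof -
    have "card e = 2" "e \<subseteq> verts K" using that by (auto simp: simple_graph_def)
    then show ?thesis by (auto simp: card_2_iff)
  qed
  have "edges H = (`) f ` edges G"
  proof (intro antisym subsetI)
    fix e assume e: "e \<in> edges H"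
    then obtain x y where xy: "e = {x, y}" "x \<in> verts H" "y \<in> verts H" using pair assms(2) by blast
    then have "x \<in> f ` verts G" "y \<in> f ` verts G" using bij_betw_imp_surj_on[OF bij] by simp_all
    then obtain u v where uv: "u \<in> verts G" "v \<in> verts G" "x = f u" "y = f v" by blast
    then have "{u, v} \<in> edges G" using f e xy by simp
    moreover have "e = f ` {u, v}" using xy uv by simp
    ultimately show "e \<in> (`) f ` edges G" by blast
  next
    fix e assume "e \<in> (`) f ` edges G"
    then obtain e' where e': "e' \<in> edges G" "e = f ` e'" by blast
    then obtain u v where "e' = {u, v}" "u \<in> verts G" "v \<in> verts G" using pair assms(1) by blast
    then show "e \<in> edges H" using e' f by simp
  qed
  then show thesis using that bij by (simp add: iso_map_def)
qed

locale graph_iso =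
  fixes G :: "'a ugraph" and H :: "'b ugraph" and f :: "'a \<Rightarrow> 'b"
  assumes simple: "simple_graph G" and iso: "iso_map f G H"
begin

lemma inj: "inj_on f (verts G)" and verts_H: "verts H = f ` verts G" and edges_H: "edges H = (`) f ` edges G"
  using iso by (auto simp: iso_map_def bij_betw_def)

lemma edge_verts: "e \<in> edges G \<Longrightarrow> e \<subseteq> verts G"
  using simple by (auto simp: simple_graph_def)

lemma edge_iff:
  assumes "e \<subseteq> verts G"
  shows "f ` e \<in> edges H \<longleftrightarrow> e \<in> edges G"
  using inj_on_image_eq_iff[OF inj assms edge_verts] by (auto simp: edges_H)

lemma isomorphic: "isomorphic G H"
  unfolding isomorphic_def
proof (intro exI conjI ballI)
  show "bij_betw f (verts G) (verts H)" using iso by (simp add: iso_map_def)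
  show "{u, v} \<in> edges G \<longleftrightarrow> {f u, f v} \<in> edges H" if "u \<in> verts G" "v \<in> verts G" for u v
    using edge_iff[of "{u, v}"] that by simp
qed

lemma walk_iff:
  assumes "set xs \<subseteq> verts G" "u \<in> verts G" "v \<in> verts G"
  shows "walk H (f u) (map f xs) (f v) \<longleftrightarrow> walk G u xs v"
proof -
  have "successively (\<lambda>x y. {f x, f y} \<in> edges H) xs \<longleftrightarrow> successively (\<lambda>x y. {x, y} \<in> edges G) xs"
  proof (rule successively_cong)
    show "{f x, f y} \<in> edges H \<longleftrightarrow> {x, y} \<in> edges G" if "x \<in> set xs" "y \<in> set xs" for x y
      using edge_iff[of "{x, y}"] that assms(1) by auto
  qed simp
  moreover have "f (hd xs) = f u \<longleftrightarrow> hd xs = u" "f (last xs) = f v \<longleftrightarrow> last xs = v" if "xs \<noteq> []"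
  proof -
    have "hd xs \<in> verts G" "last xs \<in> verts G"
      using assms(1) hd_in_set[OF that] last_in_set[OF that] by auto
    then show "f (hd xs) = f u \<longleftrightarrow> hd xs = u" "f (last xs) = f v \<longleftrightarrow> last xs = v"
      using inj_on_eq_iff[OF inj] assms by simp_all
  qed
  ultimately show ?thesis
    using assms by (auto simp: walk_def successively_map hd_map last_map verts_H)
qed

lemma gdist_eq:
  assumes "u \<in> verts G" "v \<in> verts G"
  shows "gdist H (f u) (f v) = gdist G u v"
proof -
  have "(\<exists>ys. walk H (f u) ys (f v) \<and> length ys = k) \<longleftrightarrow> (\<exists>xs. walk G u xs v \<and> length xs = k)" for k
  proof
    assume "\<exists>ys. walk H (f u) ys (f v) \<and> length ys = k"
    then obtain ys where ys: "walk H (f u) ys (f v)" "length ys = k" by blast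
    then have "ys \<in> lists (f ` verts G)" by (auto simp: walk_def verts_H)
    then obtain xs where "ys = map f xs" "set xs \<subseteq> verts G" by (auto simp: lists_image)
    then show "\<exists>xs. walk G u xs v \<and> length xs = k" using ys walk_iff assms by auto
  next
    assume "\<exists>xs. walk G u xs v \<and> length xs = k"
    then obtain xs where xs: "walk G u xs v" "length xs = k" by blast
    moreover from this have "set xs \<subseteq> verts G" by (simp add: walk_def)
    ultimately have "walk H (f u) (map f xs) (f v)" using walk_iff assms by simp
    then show "\<exists>ys. walk H (f u) ys (f v) \<and> length ys = k" using xs by (metis length_map)
  qed
  then show ?thesis by (simp add: gdist_def)
qed

lemma inj_edges: "inj_on ((`) f) (edges G)"
  using inj_on_image_Pow[OF inj] edge_verts by (auto intro: inj_on_subset)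

lemma degree_eq:
  assumes "x \<in> verts G"
  shows "degree H (f x) = degree G x"
proof -
  have "{e \<in> edges H. f x \<in> e} = (`) f ` {e \<in> edges G. x \<in> e}"
    using inj_on_image_mem_iff[OF inj assms edge_verts] by (auto simp: edges_H)
  moreover have "inj_on ((`) f) {e \<in> edges G. x \<in> e}" by (rule inj_on_subset[OF inj_edges]) auto
  ultimately show ?thesis by (simp add: degree_def card_image)
qed

lemma reverse_degree_distance_eq: "reverse_degree_distance H = reverse_degree_distance G"
proof -
  have "dist_sum H (f x) = dist_sum G x" if "x \<in> verts G" for x
    unfolding dist_sum_def verts_H sum.reindex[OF inj] using that by (simp add: gdist_eq)
  then have "degree_distance H = degree_distance G"
    unfolding degree_distance_def verts_H sum.reindex[OF inj] by (simp add: degree_eq)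
  moreover have "{gdist H u v | u v. u \<in> verts H \<and> v \<in> verts H}
      = {gdist G u v | u v. u \<in> verts G \<and> v \<in> verts G}"
  proof (intro antisym subsetI)
    fix k assume "k \<in> {gdist H u v | u v. u \<in> verts H \<and> v \<in> verts H}"
    then obtain u v where "u \<in> verts G" "v \<in> verts G" "k = gdist H (f u) (f v)"
      by (auto simp: verts_H)
    then show "k \<in> {gdist G u v | u v. u \<in> verts G \<and> v \<in> verts G}" using gdist_eq by auto
  next
    fix k assume "k \<in> {gdist G u v | u v. u \<in> verts G \<and> v \<in> verts G}"
    then obtain u v where "u \<in> verts G" "v \<in> verts G" "k = gdist H (f u) (f v)"
      using gdist_eq by auto
    then show "k \<in> {gdist H u v | u v. u \<in> verts H \<and> v \<in> verts H}" by (auto simp: verts_H)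
  qed
  then have "diameter H = diameter G" by (simp add: diameter_def)
  moreover have "card (verts H) = card (verts G)" "card (edges H) = card (edges G)"
    unfolding verts_H edges_H by (simp_all add: card_image inj inj_edges)
  ultimately show ?thesis by (simp add: reverse_degree_distance_def)
qed

end

lemma cycle_edges_map: "cycle_edges (map f xs) = (`) f ` cycle_edges xs"
proof (cases "xs = []")
  case False
  have eq: "cycle_edges ys = (\<lambda>i. {ys ! i, ys ! (Suc i mod length ys)}) ` {..<length ys}" for ys :: "'z list"
    by (auto simp: cycle_edges_def)
  have "Suc i mod length xs < length xs" for i using False by simp
  then show ?thesis unfolding eq image_image by (intro image_cong) auto
qed (simp add: cycle_edges_def)

text \<open>The images of both ends are tracked, so that corresponding leaves are attached at
  corresponding vertices. On the cycles the lists are matched index by index.\<close>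

lemma two_arms_iso_map:
  assumes ys: "cycle_list ys" and zs: "cycle_list zs" "length zs = length ys"
    and "two_arms ys \<delta> k p q G" "two_arms zs \<epsilon> k p' q' H"
  shows "\<exists>f. iso_map f G H \<and> f p = p' \<and> f q = q'"
  using assms(4,5)
proof (induction arbitrary: p' q' H)
  case start
  interpret Y: cycle_list ys by fact
  have H: "H = cycle_graph zs" "p' = zs ! 0" "q' = zs ! (length ys div 2)"
    using start(2) zs(2) by (auto elim: two_arms_0E)
  define f where "f x = zs ! Y.pos x" for x
  have "map f ys = zs" using zs(2) by (intro nth_equalityI) (auto simp: f_def)
  then have set: "f ` set ys = set zs" and ce: "(`) f ` cycle_edges ys = cycle_edges zs"
    by (metis list.set_map, metis cycle_edges_map)
  have "card (f ` set ys) = card (set ys)"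
    using zs(2) Y.dist cycle_list.dist[OF zs(1)] by (simp add: set distinct_card)
  then have "inj_on f (set ys)" by (rule eq_card_imp_inj_on[rotated]) simp
  then have "iso_map f (cycle_graph ys) H" using H set ce by (simp add: iso_map_def bij_betw_def)
  moreover have "0 < length ys" "length ys div 2 < length ys" using Y.len by auto
  then have "f (ys ! 0) = p'" "f (ys ! (length ys div 2)) = q'"
    using H Y.pos_nth by (simp_all add: f_def)
  ultimately show ?case by blast
next
  case (step k p q G v)
  obtain K p0 where K: "two_arms zs \<epsilon> k p0 p' K" "q' \<notin> verts K" "H = add_leaf K q' p0"
    using step.prems by (auto elim: two_arms_SucE)
  obtain f where f: "iso_map f G K" "f p = p0" "f q = p'" using step.IH[OF K(1)] by blast
  have "grown ys \<delta> G" "p \<in> verts G" "q \<in> verts G"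
    using cycle_list.two_arms_grown[OF ys step.hyps(1)] by auto
  then have simple: "simple_graph G" and pq: "p \<in> verts G" "q \<in> verts G"
    using cycle_list.grown_basic(1)[OF ys] by auto
  define g where "g = f(v := q')"
  have g: "g x = f x" if "x \<in> verts G" for x using that step.hyps by (auto simp: g_def)
  have gv: "g v = q'" by (simp add: g_def)
  have "bij_betw g (verts G) (verts K)"
    using f(1) bij_betw_cong[of "verts G" g f "verts K"] g by (simp add: iso_map_def)
  then have "bij_betw g (insert v (verts G)) (insert q' (verts K))"
    using notIn_Un_bij_betw[of v "verts G" g "verts K"] step.hyps K gv by simp
  moreover have "g ` e = f ` e" if "e \<in> edges G" for e
    using g simple that by (intro image_cong) (auto simp: simple_graph_def)
  then have "(`) g ` edges G = edges K"
    using f(1) by (auto simp: iso_map_def)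
  moreover have "g ` {v, p} = {q', p0}" using gv g pq f by simp
  ultimately have "iso_map g (add_leaf G v p) H" unfolding K(3) iso_map_def by simp
  moreover have "g q = p'" using g pq f by simp
  ultimately show ?case using gv by blast
qed

section \<open>The extremal graph\<close>

text \<open>\<open>U_graph\<close> for h = 0, with the arm lengths as parameters so that leaves can
  be attached one at a time.\<close>

definition arms_graph :: "nat \<Rightarrow> nat \<Rightarrow> nat \<Rightarrow> uvertex ugraph" where
  "arms_graph m a b = \<lparr>verts = Cyc ` {..<m} \<union> PathA ` {1..a} \<union> PathB ` {1..b},
     edges = cycle_edges (map Cyc [0..<m]) \<union> attached_path_edges (Cyc 0) PathA a
       \<union> attached_path_edges (Cyc (m div 2)) PathB b\<rparr>"

fun depth :: "uvertex \<Rightarrow> nat" where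
  "depth (Cyc i) = 0"
| "depth (PathA i) = i"
| "depth (PathB i) = i"
| "depth (Pendant i) = 1"

lemma attached_path_edges_0 [simp]: "attached_path_edges w p 0 = {}"
  by (simp add: attached_path_edges_def)

lemma attached_path_edges_Suc [simp]:
  "attached_path_edges w p (Suc s) = insert {if s = 0 then w else p s, p (Suc s)} (attached_path_edges w p s)"
proof -
  have *: "attached_path_edges w p s = (\<lambda>i. {if i = 0 then w else p i, p (Suc i)}) ` {..<s}" for s
    unfolding attached_path_edges_def by blast
  show ?thesis unfolding * lessThan_Suc image_insert ..
qed

lemma verts_arms_graph [simp]:
    "verts (arms_graph m a b) = Cyc ` {..<m} \<union> PathA ` {1..a} \<union> PathB ` {1..b}"
  and edges_arms_graph [simp]:
    "edges (arms_graph m a b) = cycle_edges (map Cyc [0..<m]) \<union> attached_path_edges (Cyc 0) PathA a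
       \<union> attached_path_edges (Cyc (m div 2)) PathB b"
  by (simp_all add: arms_graph_def)

lemma arms_graph_SucA:
  "arms_graph m (Suc a) b = add_leaf (arms_graph m a b) (PathA (Suc a)) (if a = 0 then Cyc 0 else PathA a)"
proof (rule ugraph.equality)
  have "{1..Suc a} = insert (Suc a) {1..a}" by auto
  then show "verts (arms_graph m (Suc a) b) = verts (add_leaf (arms_graph m a b) (PathA (Suc a)) (if a = 0 then Cyc 0 else PathA a))"
    unfolding verts_arms_graph verts_add_leaf by blast
qed (auto simp: insert_commute)

lemma arms_graph_SucB:
  "arms_graph m a (Suc b) = add_leaf (arms_graph m a b) (PathB (Suc b)) (if b = 0 then Cyc (m div 2) else PathB b)"
proof (rule ugraph.equality)
  have "{1..Suc b} = insert (Suc b) {1..b}" by auto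
  then show "verts (arms_graph m a (Suc b)) = verts (add_leaf (arms_graph m a b) (PathB (Suc b)) (if b = 0 then Cyc (m div 2) else PathB b))"
    unfolding verts_arms_graph verts_add_leaf by blast
qed (auto simp: insert_commute)

text \<open>\<open>A\<close> and \<open>B\<close> are the current ends of the arms; an arm of length
  0 ends in its cycle vertex. Each induction step attaches a leaf to either arm, and the odd stage
  in between is stated too, as both parities are needed.\<close>

lemma two_arms_arms_graph_aux:
  fixes m :: nat
  assumes "3 \<le> m"
  defines "A \<equiv> \<lambda>a. if a = 0 then Cyc 0 else PathA a"
    and "B \<equiv> \<lambda>b. if b = 0 then Cyc (m div 2) else PathB b"
  shows "two_arms (map Cyc [0..<m]) depth (2 * j) (A j) (B j) (arms_graph m j j) \<and>
    two_arms (map Cyc [0..<m]) depth (Suc (2 * j)) (B j) (A (Suc j)) (arms_graph m (Suc j) j)"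
proof (induction j)
  have stepA: "two_arms (map Cyc [0..<m]) depth (Suc (2 * j)) (B j) (A (Suc j)) (arms_graph m (Suc j) j)"
    if "two_arms (map Cyc [0..<m]) depth (2 * j) (A j) (B j) (arms_graph m j j)" for j
  proof -
    have "two_arms (map Cyc [0..<m]) depth (Suc (2 * j)) (B j) (PathA (Suc j))
        (add_leaf (arms_graph m j j) (PathA (Suc j)) (A j))"
      by (rule two_arms.step[OF that]) (auto simp: arms_graph_def A_def)
    then show ?thesis by (simp add: arms_graph_SucA A_def)
  qed
  have stepB: "two_arms (map Cyc [0..<m]) depth (Suc (Suc (2 * j))) (A (Suc j)) (B (Suc j)) (arms_graph m (Suc j) (Suc j))"
    if "two_arms (map Cyc [0..<m]) depth (Suc (2 * j)) (B j) (A (Suc j)) (arms_graph m (Suc j) j)" for j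
  proof -
    have "two_arms (map Cyc [0..<m]) depth (Suc (Suc (2 * j))) (A (Suc j)) (PathB (Suc j))
        (add_leaf (arms_graph m (Suc j) j) (PathB (Suc j)) (B j))"
      by (rule two_arms.step[OF that]) (auto simp: arms_graph_def B_def)
    then show ?thesis by (simp add: arms_graph_SucB B_def)
  qed
  {
    case 0
    have "arms_graph m 0 0 = cycle_graph (map Cyc [0..<m])"
      by (auto simp: arms_graph_def cycle_graph_def)
    moreover have "two_arms (map Cyc [0..<m]) depth 0 (map Cyc [0..<m] ! 0)
        (map Cyc [0..<m] ! (length (map Cyc [0..<m]) div 2)) (cycle_graph (map Cyc [0..<m]))"
      by (rule two_arms.start) auto
    ultimately have "two_arms (map Cyc [0..<m]) depth (2 * 0) (A 0) (B 0) (arms_graph m 0 0)"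
      using assms by simp
    then show ?case using stepA by blast
  next
    case (Suc j)
    then have "two_arms (map Cyc [0..<m]) depth (2 * Suc j) (A (Suc j)) (B (Suc j)) (arms_graph m (Suc j) (Suc j))"
      using stepB[of j] by simp
    then show ?case using stepA by blast
  }
qed

lemma two_arms_arms_graph:
  assumes "3 \<le> m"
  shows "\<exists>p q. two_arms (map Cyc [0..<m]) depth k p q (arms_graph m (Suc k div 2) (k div 2))"
proof (cases "even k")
  case True
  then obtain j where "k = 2 * j" by blast
  then show ?thesis using two_arms_arms_graph_aux[OF assms, of j] by auto
next
  case False
  then obtain j where "k = Suc (2 * j)" using oddE by fastforce
  then show ?thesis using two_arms_arms_graph_aux[OF assms, of j] by auto
qed

section \<open>The prescribed arm lengths\<close>

lemma balanced_split:
  fixes a b k :: nat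
  assumes "a + b = k" "a \<le> Suc b"
  shows "int a - int b \<le> int (Suc k div 2) - int (k div 2)"
    and "int (Suc k div 2) - int (k div 2) \<le> int a - int b \<Longrightarrow> a = Suc k div 2 \<and> b = k div 2"
proof -
  \<comment> \<open>The difference of the lengths has the parity of \<open>k\<close>, so under the
    bound 1 its greatest value is 0 or 1.\<close>
  consider j where "k = 2 * j" | j where "k = Suc (2 * j)" by (metis evenE oddE Suc_eq_plus1)
  then have "int a - int b \<le> int (Suc k div 2) - int (k div 2) \<and>
    (int (Suc k div 2) - int (k div 2) \<le> int a - int b \<longrightarrow> a = Suc k div 2 \<and> b = k div 2)"
  proof cases
    case 1
    moreover from this have "a \<le> b" using assms by arith
    ultimately show ?thesis using assms by auto
  next
    case 2
    then show ?thesis using assms by auto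
  qed
  then show "int a - int b \<le> int (Suc k div 2) - int (k div 2)"
    and "int (Suc k div 2) - int (k div 2) \<le> int a - int b \<Longrightarrow> a = Suc k div 2 \<and> b = k div 2"
    by auto
qed

lemma path_lengths_eq:
  assumes "m \<le> n"
  shows "path_lengths n m (n - (m + 1) div 2) = (Suc (n - m) div 2, (n - m) div 2)"
proof -
  define P where "P = (\<lambda>(\<gamma>::nat, \<theta>::nat). \<gamma> + \<theta> + m div 2 = n - (m + 1) div 2 \<and>
    real \<gamma> - real \<theta> \<le> alpha n m (n - (m + 1) div 2) + 1)"
  define F where "F = (\<lambda>(\<gamma>::nat, \<theta>::nat). int \<gamma> - int \<theta>)"
  define k where "k = n - m"
  define top where "top = (Suc k div 2, k div 2)"
  have "num_pendants n m (n - (m + 1) div 2) = 0" by (simp add: num_pendants_def)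
  \<comment> \<open>Without pendant vertices the constraint on the arms becomes \<gamma> - \<theta>
    \<le> 1.\<close>
  then have "alpha n m (n - (m + 1) div 2) = 0" by (simp add: alpha_def)
  moreover have "n - (m + 1) div 2 = k + m div 2" using assms unfolding k_def by linarith
  ultimately have P: "P (a, b) \<longleftrightarrow> a + b = k \<and> a \<le> Suc b" for a b
    by (auto simp: P_def)
  have F: "F (a, b) = int a - int b" for a b by (simp add: F_def)
  have "Suc k div 2 + k div 2 = k" "Suc k div 2 \<le> Suc (k div 2)" by linarith+
  then have top: "P top" by (simp add: top_def P)
  \<comment> \<open>\<open>arg_max\<close> chooses some maximiser, so its value is known only after
    every maximiser has been shown to equal \<open>top\<close>.\<close>
  have "arg_max F P = top"
    unfolding arg_max_def
  proof (rule some_equality)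
    have "F (a, b) \<le> F top" if "P (a, b)" for a b
      using that balanced_split(1)[of a b k] by (simp add: P F top_def)
    then show "is_arg_max F P top"
      unfolding is_arg_max_def using top by (metis not_less surj_pair)
  next
    fix x assume x: "is_arg_max F P x"
    obtain a b where ab: "x = (a, b)" by (cases x)
    have "F top \<le> F (a, b)" "P (a, b)"
      using x top unfolding is_arg_max_def ab by (meson not_less)+
    then show "x = top" using balanced_split(2)[of a b k] by (simp add: P F top_def ab)
  qed
  then show ?thesis by (simp add: path_lengths_def P_def F_def top_def k_def)
qed

lemma U_graph_eq:
  assumes "m \<le> n"
  shows "U_graph n m (n - (m + 1) div 2) = arms_graph m (Suc (n - m) div 2) ((n - m) div 2)"
  unfolding U_graph_def path_lengths_eq[OF assms] by (simp add: num_pendants_def arms_graph_def)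

theorem theorem2:
  fixes G :: "'a ugraph" and n m :: nat
  assumes "unicyclic G"
    and "card (verts G) = n"
    and "girth G = m"
    and "n \<ge> 6"
    and "3 \<le> m" and "m \<le> n - 2"
  shows "reverse_degree_distance G
           \<le> reverse_degree_distance (U_graph n m (n - (m + 1) div 2)) \<and>
         (reverse_degree_distance G
            = reverse_degree_distance (U_graph n m (n - (m + 1) div 2)) \<longleftrightarrow>
          isomorphic G (U_graph n m (n - (m + 1) div 2)))"
proof -
  define U where "U = U_graph n m (n - (m + 1) div 2)"
  define zs where "zs = map Cyc [0..<m]"
  obtain xs \<delta> where xs: "cycle_list xs" "length xs = m" "grown xs \<delta> G"
    using unicyclic_imp_grown[OF assms(1)] assms(3) by metis
  have mn: "m \<le> n" using assms by simp
  have zs: "cycle_list zs" "length zs = length xs"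
    using assms(5) xs(2) by (auto simp: zs_def cycle_list_def distinct_map inj_on_def)
  obtain p q where U: "two_arms zs depth (n - m) p q U"
    using two_arms_arms_graph[OF assms(5)] U_graph_eq[OF mn] unfolding U_def zs_def by metis
  have card: "card (verts G) = length xs + (n - m)" using assms(2) mn xs(2) by simp
  note bound = grown_le_two_arms[OF xs(1,3) zs U card]
  have simpleG: "simple_graph G" using assms(1) by (simp add: unicyclic_def)
  have "grown zs depth U" using cycle_list.two_arms_grown[OF zs(1) U] by simp
  then have simpleU: "simple_graph U" by (rule cycle_list.grown_basic(1)[OF zs(1)])
  have "isomorphic G U" if eq: "reverse_degree_distance G = reverse_degree_distance U"
  proof -
    obtain ys p' q' where ys: "cycle_list ys" "length ys = length xs" "two_arms ys \<delta> (n - m) p' q' G"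
      using bound eq by blast
    \<comment> \<open>\<open>G\<close> and \<open>U\<close> are now two-arm graphs with the same
      \<open>k\<close> over cycles of the same length.\<close>
    then obtain f where "iso_map f G U"
      using two_arms_iso_map[OF ys(1) zs(1) _ ys(3) U] zs(2) by auto
    then show ?thesis using graph_iso.isomorphic simpleG by (metis graph_iso.intro)
  qed
  moreover have "reverse_degree_distance G = reverse_degree_distance U" if "isomorphic G U"
  proof -
    obtain f where "iso_map f G U" using isomorphic_imp_iso_map[OF simpleG simpleU \<open>isomorphic G U\<close>] .
    then show ?thesis using graph_iso.reverse_degree_distance_eq simpleG by (metis graph_iso.intro)
  qed
  ultimately show ?thesis using bound unfolding U_def[symmetric] by blast
qed

end
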